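(* Let $m_1,m_2\in\mathbb{N}$ and let $v:[0,\infty)\to\mathbb{C}^{m_1\times m_2}$ be measurable and locally summable. Consider the Dirac system $$\frac{d}{dx}y(x,z)=\mathrm{i}\,(zj+jV(x))\,y(x,z)\quad (x\ge 0),\qquad j=\begin{bmatrix} I_{m_1}&0\\ 0&-I_{m_2}\end{bmatrix},\quad V=\begin{bmatrix}0&v\\ v^*&0\end{bmatrix}.$$ Then the sets $\mathcal{N}(x,z)$ ($x\in[0,\infty)$, $z\in\mathbb{C}_+$), defined in the context, are well-defined (that is, the $m_1\times m_1$ matrix inverted in their definition is invertible). Moreover, there is a unique $m_2\times m_1$ matrix function $\varphi(z)$ in $\mathbb{C}_+$ such that $$\{\varphi(z)\}=\bigcap_{0\le x<\infty}\mathcal{N}(x,z)\qquad (z\in\mathbb{C}_+),$$ and this function $\varphi$ is analytic in $\mathbb{C}_+$ and non-expansive, i.e. $\varphi(z)^*\varphi(z)\le I_{m_1}$ for $z\in\mathbb{C}_+$.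
   Context: $\mathbb{C}_+$ is the open upper half-plane, $I_k$ is the $k\times k$ identity matrix, $m:=m_1+m_2$. Locally summable means summable (Lebesgue integrable) on every finite interval $[0,l]$. The fundamental solution $u(x,z)$ of the Dirac system is the $m\times m$ matrix solution (locally absolutely continuous in $x$, the equation holding for a.e. $x$) normalized by $u(0,z)=I_m$. An $m\times m_1$ matrix function $\mathcal{P}(z)$, meromorphic in $\mathbb{C}_+$, is called nonsingular with property-$j$ if, for all $z\in\mathbb{C}_+$ excluding possibly a discrete set of points, $$\mathcal{P}(z)^*\mathcal{P}(z)>0,\qquad \mathcal{P}(z)^*j\mathcal{P}(z)\ge 0 .$$ For $x\ge0$ and $z\in\mathbb{C}_+$, $\mathcal{N}(x,z)$ is the set of values at $x,z$ of the matrix functions $$\varphi(x,z,\mathcal{P})=\begin{bmatrix}0&I_{m_2}\end{bmatrix}u(x,z)^{-1}\mathcal{P}(z)\Big(\begin{bmatrix}I_{m_1}&0\end{bmatrix}u(x,z)^{-1}\mathcal{P}(z)\Big)^{-1},$$ where $\mathcal{P}$ runs over the nonsingular matrix functions with property-$j$ (for given $z$, those $\mathcal{P}$ for which $z$ is not in the exceptional discrete set). *)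

theory Defs
  imports "HOL-Complex_Analysis.Complex_Analysis"
begin

definition upper_half_plane :: "complex set"  (\<open>\<complex>\<^sub>+\<close>) where
  "\<complex>\<^sub>+ = {z. 0 < Im z}"

definition mat_adj :: "complex^'n^'m \<Rightarrow> complex^'m^'n" where
  "mat_adj A = (\<chi> i k. cnj (A $ k $ i))"

definition quad_form :: "complex^'n^'n \<Rightarrow> complex^'n \<Rightarrow> complex" where
  "quad_form A x = (\<Sum>i\<in>UNIV. cnj (x $ i) * (A *v x) $ i)"

definition pos_def :: "complex^'n^'n \<Rightarrow> bool" where
  "pos_def A \<longleftrightarrow> mat_adj A = A \<and> (\<forall>x. x \<noteq> 0 \<longrightarrow> 0 < Re (quad_form A x))"

definition pos_semidef :: "complex^'n^'n \<Rightarrow> bool" where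
  "pos_semidef A \<longleftrightarrow> mat_adj A = A \<and> (\<forall>x. 0 \<le> Re (quad_form A x))"

definition loewner_le :: "complex^'n^'n \<Rightarrow> complex^'n^'n \<Rightarrow> bool" where
  "loewner_le A B \<longleftrightarrow> pos_semidef (B - A)"

definition row_block :: "'a^'n1^'m \<Rightarrow> 'a^'n2^'m \<Rightarrow> 'a^('n1 + 'n2)^'m" where
  "row_block A B = (\<chi> i k. case k of Inl b \<Rightarrow> A $ i $ b | Inr b \<Rightarrow> B $ i $ b)"

definition four_block ::
    "'a^'n1^'m1 \<Rightarrow> 'a^'n2^'m1 \<Rightarrow> 'a^'n1^'m2 \<Rightarrow> 'a^'n2^'m2 \<Rightarrow> 'a^('n1 + 'n2)^('m1 + 'm2)" where
  "four_block A B C D =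
    (\<chi> i. case i of Inl a \<Rightarrow> row_block A B $ a | Inr a \<Rightarrow> row_block C D $ a)"

definition sig_j :: "complex^('m1::finite + 'm2::finite)^('m1 + 'm2)" where
  "sig_j = four_block (mat 1) 0 0 (- mat 1)"

definition pot_V :: "complex^'m2^'m1 \<Rightarrow> complex^('m1 + 'm2)^('m1 + 'm2)" where
  "pot_V w = four_block 0 w (mat_adj w) 0"

text \<open>Absolute continuity of a function on a compact interval; the library constant
  \<^const>\<open>absolutely_continuous\<close> is the notion for measures.\<close>

definition abs_cont_on_interval :: "(real \<Rightarrow> 'a::real_normed_vector) \<Rightarrow> real \<Rightarrow> real \<Rightarrow> bool" where
  "abs_cont_on_interval f a b \<longleftrightarrow>
    (\<forall>\<epsilon>>0. \<exists>\<delta>>0. \<forall>(n::nat) s t.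
      (\<forall>k<n. a \<le> s k \<and> s k \<le> t k \<and> t k \<le> b) \<and>
      disjoint_family_on (\<lambda>k. {s k<..<t k}) {..<n} \<and>
      (\<Sum>k<n. t k - s k) < \<delta>
      \<longrightarrow> (\<Sum>k<n. norm (f (t k) - f (s k))) < \<epsilon>)"

text \<open>Here \<^term>\<open>mat c ** A\<close> is the multiple of the matrix \<^term>\<open>A\<close> by the complex scalar
  \<^term>\<open>c\<close>.\<close>

definition is_fundamental_solution ::
    "(real \<Rightarrow> complex^'m2^'m1) \<Rightarrow> complex \<Rightarrow> (real \<Rightarrow> complex^('m1 + 'm2)^('m1 + 'm2)) \<Rightarrow> bool" where
  "is_fundamental_solution v z u \<longleftrightarrow>
    u 0 = mat 1 \<and>
    (\<forall>l\<ge>0. abs_cont_on_interval u 0 l) \<and>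
    (AE x in lebesgue_on {0..}.
      (u has_vector_derivative
        mat \<i> ** (mat z ** sig_j + sig_j ** pot_V (v x)) ** u x) (at x within {0..}))"

text \<open>The fundamental solution exists and is uniquely determined on \<^term>\<open>{0::real..}\<close> when
  \<^term>\<open>v\<close> is locally summable; the choice operator only leaves open its values at negative
  arguments, which are never used.\<close>

definition fund_sol ::
    "(real \<Rightarrow> complex^'m2^'m1) \<Rightarrow> real \<Rightarrow> complex \<Rightarrow> complex^('m1 + 'm2)^('m1 + 'm2)" where
  "fund_sol v x z = (SOME u. is_fundamental_solution v z u) x"

text \<open>The points of the upper half-plane at which \<open>P\<close> is not regular or one of the two
  inequalities fails. Regularity is required explicitly because a function that is
  \<^const>\<open>meromorphic_on\<close> a set may take arbitrary values at its singularities.\<close>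

definition exceptional_set :: "(complex \<Rightarrow> complex^'m1^('m1 + 'm2::finite)) \<Rightarrow> complex set" where
  "exceptional_set P =
    {z \<in> \<complex>\<^sub>+. \<not> ((\<forall>i k. (\<lambda>w. P w $ i $ k) analytic_on {z}) \<and>
               pos_def (mat_adj (P z) ** P z) \<and>
               pos_semidef (mat_adj (P z) ** sig_j ** P z))}"

definition nonsingular_property_j :: "(complex \<Rightarrow> complex^'m1^('m1 + 'm2::finite)) \<Rightarrow> bool" where
  "nonsingular_property_j P \<longleftrightarrow>
    (\<forall>i k. (\<lambda>w. P w $ i $ k) meromorphic_on \<complex>\<^sub>+) \<and> exceptional_set P sparse_in \<complex>\<^sub>+"

definition weyl_denom ::
    "(real \<Rightarrow> complex^'m2^'m1) \<Rightarrow> real \<Rightarrow> complex \<Rightarrow> (complex \<Rightarrow> complex^'m1^('m1 + 'm2))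
      \<Rightarrow> complex^'m1^'m1" where
  "weyl_denom v x z P = row_block (mat 1) 0 ** matrix_inv (fund_sol v x z) ** P z"

definition weyl_phi ::
    "(real \<Rightarrow> complex^'m2^'m1) \<Rightarrow> real \<Rightarrow> complex \<Rightarrow> (complex \<Rightarrow> complex^'m1^('m1 + 'm2))
      \<Rightarrow> complex^'m1^'m2" where
  "weyl_phi v x z P =
    row_block 0 (mat 1) ** matrix_inv (fund_sol v x z) ** P z ** matrix_inv (weyl_denom v x z P)"

definition weyl_set ::
    "(real \<Rightarrow> complex^'m2^'m1) \<Rightarrow> real \<Rightarrow> complex \<Rightarrow> (complex^'m1^'m2) set" where
  "weyl_set v x z =
    {weyl_phi v x z P | P. nonsingular_property_j P \<and> z \<notin> exceptional_set P}"

end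

theory Submission
  imports Defs
begin

text \<open>
  Write \<open>u\<close> for the fundamental solution and \<open>[f; g]\<close> for a column with blocks \<open>f\<close> and \<open>g\<close>. The
  system gives \<open>(u\<^sup>* j u)' = - 2 Im z u\<^sup>* u\<close>, so the forms \<open>u\<^sup>* j u \<le> j\<close> decrease in \<open>x\<close>, and
  \<open>u(x, cnj z)\<^sup>* j u(x, z) = j\<close>, so \<open>u\<close> is invertible and unique. Since every matrix satisfying
  the two inequalities is the value of a constant \<open>P\<close>, the set \<open>\<N>(x, z)\<close> consists of all \<open>\<phi>\<close> with
  \<open>[I; \<phi>]\<^sup>* u\<^sup>* j u [I; \<phi>] \<ge> 0\<close>; these sets are closed and decreasing in \<open>x\<close>. For \<open>\<phi>\<close> in
  \<open>\<N>(x, z)\<close> one gets \<open>2 Im z \<integral>\<^sub>0\<^sup>x |u [f; \<phi> f]|\<^sup>2 \<le> |f|\<^sup>2\<close>, while \<open>|u [0; h]| \<ge> |h|\<close>. Applied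
  with \<open>h = (\<phi> - \<psi>) f\<close>, this bounds the diameter of \<open>\<N>(x, z)\<close> by a multiple of
  \<open>(x Im z) powr (- 1 / 2)\<close>, locally uniformly in \<open>z\<close>. Hence \<open>\<phi>(z)\<close> is the locally uniform limit
  of the values belonging to the constant \<open>P = [I; 0]\<close>, which are analytic because \<open>u(x, z)\<close> is
  entire in \<open>z\<close>, being a locally uniform limit of Picard iterates polynomial in \<open>z\<close>.
\<close>

section \<open>Absolutely continuous functions\<close>

text \<open>The defining condition ranges over initial segments of the naturals. Reindexing by a
  bijection allows any finite index set, in particular the pairs of a tagged division.\<close>

lemma abs_cont_on_intervalD:
  fixes f :: "real \<Rightarrow> 'a::real_normed_vector"
  assumes "abs_cont_on_interval f a b" "\<epsilon> > 0"
  shows "\<exists>\<delta>>0. \<forall>(I :: 'i set) s t. finite I \<and> (\<forall>i\<in>I. a \<le> s i \<and> s i \<le> t i \<and> t i \<le> b) \<and>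
      disjoint_family_on (\<lambda>i. {s i<..<t i}) I \<and> (\<Sum>i\<in>I. t i - s i) < \<delta> \<longrightarrow>
      (\<Sum>i\<in>I. norm (f (t i) - f (s i))) < \<epsilon>"
proof -
  obtain \<delta> where \<delta>: "\<delta> > 0" "\<And>n s t. (\<forall>k<n. a \<le> s k \<and> s k \<le> t k \<and> t k \<le> b) \<and>
      disjoint_family_on (\<lambda>k. {s k<..<t k}) {..<n} \<and> (\<Sum>k<(n::nat). t k - s k) < \<delta> \<longrightarrow>
      (\<Sum>k<n. norm (f (t k) - f (s k))) < \<epsilon>"
    using assms unfolding abs_cont_on_interval_def by blast
  show ?thesis
  proof (intro exI[of _ \<delta>] conjI allI impI \<delta>(1))
    fix I :: "'i set" and s t
    assume *: "finite I \<and> (\<forall>i\<in>I. a \<le> s i \<and> s i \<le> t i \<and> t i \<le> b) \<and>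
      disjoint_family_on (\<lambda>i. {s i<..<t i}) I \<and> (\<Sum>i\<in>I. t i - s i) < \<delta>"
    then have st: "\<And>i. i \<in> I \<Longrightarrow> a \<le> s i \<and> s i \<le> t i \<and> t i \<le> b"
      and disj: "disjoint_family_on (\<lambda>i. {s i<..<t i}) I" and len: "(\<Sum>i\<in>I. t i - s i) < \<delta>"
      by auto
    obtain h where h: "bij_betw h {..<card I} I"
      using ex_bij_betw_nat_finite * by (metis atLeast0LessThan)
    have "(\<Sum>k<card I. norm (f ((t \<circ> h) k) - f ((s \<circ> h) k))) < \<epsilon>"
    proof (rule \<delta>(2)[rule_format], intro conjI)
      show "\<forall>k<card I. a \<le> (s \<circ> h) k \<and> (s \<circ> h) k \<le> (t \<circ> h) k \<and> (t \<circ> h) k \<le> b"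
        using st h by (auto simp: bij_betw_def)
      show "disjoint_family_on (\<lambda>k. {(s \<circ> h) k<..<(t \<circ> h) k}) {..<card I}"
        unfolding disjoint_family_on_def
      proof (intro ballI impI)
        fix k l assume kl: "k \<in> {..<card I}" "l \<in> {..<card I}" "k \<noteq> l"
        then have "h k \<in> I" "h l \<in> I" "h k \<noteq> h l"
          using h by (auto simp: bij_betw_def inj_on_def)
        then show "{(s \<circ> h) k<..<(t \<circ> h) k} \<inter> {(s \<circ> h) l<..<(t \<circ> h) l} = {}"
          using disj unfolding disjoint_family_on_def comp_def by blast
      qed
      show "(\<Sum>k<card I. (t \<circ> h) k - (s \<circ> h) k) < \<delta>"
        using len sum.reindex_bij_betw[OF h, of "\<lambda>i. t i - s i"] by simp
    qed
    then show "(\<Sum>i\<in>I. norm (f (t i) - f (s i))) < \<epsilon>"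
      using sum.reindex_bij_betw[OF h, of "\<lambda>i. norm (f (t i) - f (s i))"] by simp
  qed
qed

text \<open>Serves to bound the total length of the intervals whose tags lie in a null set by the
  measure of an open cover of that set.\<close>

lemma sum_length_disjoint_intervals_le:
  fixes s t :: "'i \<Rightarrow> real"
  assumes "finite I" "\<And>i. i \<in> I \<Longrightarrow> s i \<le> t i" "disjoint_family_on (\<lambda>i. {s i<..<t i}) I"
    and "\<And>i. i \<in> I \<Longrightarrow> {s i<..<t i} \<subseteq> U" "U \<in> lmeasurable"
  shows "(\<Sum>i\<in>I. t i - s i) \<le> measure lebesgue U"
proof -
  have "(\<Sum>i\<in>I. t i - s i) = (\<Sum>i\<in>I. measure lebesgue {s i<..<t i})"
    using assms(2) by (intro sum.cong) auto
  also have "\<dots> = measure lebesgue (\<Union>i\<in>I. {s i<..<t i})"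
    using assms(1,3) by (intro measure_finite_Union[symmetric]) (auto simp: image_subset_iff assms(2))
  also have "\<dots> \<le> measure lebesgue U"
    using assms(1,4,5) by (intro measure_mono_fmeasurable) auto
  finally show ?thesis .
qed

text \<open>The fundamental theorem of calculus, obtained directly from Riemann sums. Intervals
  tagged in \<open>N\<close> lie in an open set of small measure, so absolute continuity makes their
  increments small; on the others the derivative at the tag approximates the increment.\<close>

lemma abs_cont_has_integral_derivative:
  fixes f :: "real \<Rightarrow> 'a::banach"
  assumes ac: "abs_cont_on_interval f a b" and ab: "a \<le> b" and N: "negligible N"
    and der: "\<And>x. x \<in> {a..b} - N \<Longrightarrow> (f has_vector_derivative g x) (at x within {a..b})"
  shows "(g has_integral f b - f a) {a..b}"
proof -
  \<comment> \<open>Setting the integrand to 0 on \<open>N\<close> removes the tags in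
    \<open>N\<close> from the Riemann sum; only the increments of \<open>f\<close> remain to be
    estimated there.\<close>
  define g' where "g' x = (if x \<in> N then 0 else g x)" for x
  have "(g' has_integral f b - f a) {a..b}"
    unfolding has_integral_real
  proof (intro allI impI)
    fix e :: real assume e: "e > 0"
    define e1 where "e1 = e / 4"
    \<comment> \<open>The tags outside \<open>N\<close> cost at most \<open>e2 * (b - a)\<close>,
      hence at most e/4; the summand 1 keeps the denominator positive when
      \<open>a = b\<close>.\<close>
    define e2 where "e2 = e / (4 * (b - a + 1))"
    have e1: "e1 > 0" and e2: "e2 > 0" using e ab by (auto simp: e1_def e2_def)
    obtain \<delta> where \<delta>: "\<delta> > 0"
      "\<And>(I :: (real \<times> real set) set) s t. finite I \<and> (\<forall>i\<in>I. a \<le> s i \<and> s i \<le> t i \<and> t i \<le> b) \<and>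
      disjoint_family_on (\<lambda>i. {s i<..<t i}) I \<and> (\<Sum>i\<in>I. t i - s i) < \<delta> \<longrightarrow>
      (\<Sum>i\<in>I. norm (f (t i) - f (s i))) < e1"
      using abs_cont_on_intervalD[OF ac e1] by blast
    have "N \<in> sets lebesgue" using N by (rule negligible_imp_sets)
    from sets_lebesgue_outer_open[OF this \<delta>(1)]
    obtain U where U: "open U" "N \<subseteq> U" "(U - N) \<in> lmeasurable" "emeasure lebesgue (U - N) < ennreal \<delta>"
      by blast
    have Ulm: "U \<in> lmeasurable"
      using fmeasurable.Un[OF U(3) negligible_imp_measurable[OF N]] U(2)
      by (simp add: Un_absorb2)
    have "measure lebesgue U = measure lebesgue (U - N)"
      using measure_Diff_null_set[of U lebesgue N] N Ulm
      by (simp add: negligible_iff_null_sets fmeasurableD)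
    also have "\<dots> < \<delta>"
      using U(3,4) \<delta>(1) by (simp add: emeasure_eq_measure2 fmeasurableD2 ennreal_less_iff)
    finally have mU: "measure lebesgue U < \<delta>" .
    \<comment> \<open>The gauge: around a point of \<open>N\<close> the ball stays inside
      \<open>U\<close>, around any other point of the interval the derivative estimate holds with
      error \<open>e2\<close>. Points outside the interval never occur as tags.\<close>
    have "\<exists>d>0. (x \<in> N \<longrightarrow> ball x d \<subseteq> U) \<and>
        (x \<in> {a..b} - N \<longrightarrow> (\<forall>y\<in>{a..b}. \<bar>y - x\<bar> < d \<longrightarrow>
          norm (f y - f x - (y - x) *\<^sub>R g x) \<le> e2 * \<bar>y - x\<bar>))" for x
    proof (cases "x \<in> N")
      case True
      then show ?thesis using U(1,2) unfolding open_contains_ball by blast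
    next
      case False
      show ?thesis
      proof (cases "x \<in> {a..b}")
        case True
        with \<open>x \<notin> N\<close> der[of x] e2 obtain d where "d > 0"
          "\<forall>y\<in>{a..b}. norm (y - x) < d \<longrightarrow> norm (f y - f x - (y - x) *\<^sub>R g x) \<le> e2 * norm (y - x)"
          unfolding has_vector_derivative_def has_derivative_within_alt by blast
        with \<open>x \<notin> N\<close> show ?thesis by (intro exI[of _ d]) auto
      next
        case False
        with \<open>x \<notin> N\<close> show ?thesis by (intro exI[of _ 1]) auto
      qed
    qed
    then obtain d where d: "\<And>x. d x > 0" "\<And>x. x \<in> N \<Longrightarrow> ball x (d x) \<subseteq> U"
      "\<And>x y. x \<in> {a..b} - N \<Longrightarrow> y \<in> {a..b} \<Longrightarrow> \<bar>y - x\<bar> < d x \<Longrightarrow>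
          norm (f y - f x - (y - x) *\<^sub>R g x) \<le> e2 * \<bar>y - x\<bar>"
      by metis
    show "\<exists>\<gamma>. gauge \<gamma> \<and> (\<forall>\<D>. \<D> tagged_division_of {a..b} \<and> \<gamma> fine \<D> \<longrightarrow>
        norm ((\<Sum>(x, k)\<in>\<D>. measure lborel k *\<^sub>R g' x) - (f b - f a)) < e)"
    proof (intro exI conjI allI impI)
      show "gauge (\<lambda>x. ball x (d x))" using d(1) by (simp add: gauge_def)
      fix p assume p: "p tagged_division_of {a..b} \<and> (\<lambda>x. ball x (d x)) fine p"
      then have pd: "p tagged_division_of {a..b}" and fine: "(\<lambda>x. ball x (d x)) fine p" by auto
      have fin: "finite p" using pd by blast
      define s t where "s = (\<lambda>(x::real,K::real set). Inf K)" and "t = (\<lambda>(x::real,K::real set). Sup K)"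
      have st: "snd i = {s i..t i} \<and> s i \<le> t i \<and> a \<le> s i \<and> t i \<le> b \<and> s i \<le> fst i \<and> fst i \<le> t i"
        if i: "i \<in> p" for i
      proof -
        have xK: "(fst i, snd i) \<in> p" using i by simp
        obtain c d where cd: "snd i = {c..d}" using tagged_division_ofD(4)[OF pd xK] by auto
        have "fst i \<in> {c..d}" "{c..d} \<subseteq> {a..b}"
          using tagged_division_ofD(2,3)[OF pd xK] cd by auto
        moreover from this have "s i = c" "t i = d" using cd by (auto simp: s_def t_def split_beta)
        ultimately show ?thesis using cd by auto
      qed
      have fine': "{s i..t i} \<subseteq> ball (fst i) (d (fst i))" if "i \<in> p" for i
        using fineD[OF fine, of "fst i" "snd i"] st[OF that] that by (metis prod.collapse)
      define pN where "pN = {i \<in> p. fst i \<in> N}"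
      \<comment> \<open>The tag lies between the two endpoints, so the errors on its left and right
        add up to \<open>e2\<close> times the length of the interval.\<close>
      have good: "norm ((t i - s i) *\<^sub>R g' (fst i) - (f (t i) - f (s i))) \<le> e2 * (t i - s i)"
        if "i \<in> p - pN" for i
      proof -
        let ?x = "fst i"
        have x: "?x \<in> {a..b} - N" and i: "i \<in> p" using that st[of i] by (auto simp: pN_def)
        note st = st[OF i]
        have "s i \<in> ball ?x (d ?x)" "t i \<in> ball ?x (d ?x)"
          using st by (intro subsetD[OF fine'[OF i]]; simp)+
        then have "norm (f (s i) - f ?x - (s i - ?x) *\<^sub>R g ?x) \<le> e2 * \<bar>s i - ?x\<bar>"
          "norm (f (t i) - f ?x - (t i - ?x) *\<^sub>R g ?x) \<le> e2 * \<bar>t i - ?x\<bar>"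
          using st by (intro d(3)[OF x]; simp add: dist_real_def abs_minus_commute)+
        moreover have "(t i - s i) *\<^sub>R g' ?x - (f (t i) - f (s i)) =
          (f (s i) - f ?x - (s i - ?x) *\<^sub>R g ?x) - (f (t i) - f ?x - (t i - ?x) *\<^sub>R g ?x)"
          using x by (simp add: g'_def algebra_simps)
        ultimately have "norm ((t i - s i) *\<^sub>R g' ?x - (f (t i) - f (s i)))
            \<le> e2 * \<bar>s i - ?x\<bar> + e2 * \<bar>t i - ?x\<bar>"
          by (simp only: norm_triangle_le_diff add_mono)
        also have "\<dots> = e2 * (t i - s i)" using st by (simp add: algebra_simps)
        finally show ?thesis .
      qed
      have disj: "disjoint_family_on (\<lambda>i. {s i<..<t i}) p"
        unfolding disjoint_family_on_def
      proof (intro ballI impI)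
        fix i k assume ik: "i \<in> p" "k \<in> p" "i \<noteq> k"
        have "interior (snd i) \<inter> interior (snd k) = {}"
          using tagged_division_ofD(5)[OF pd, of "fst i" "snd i" "fst k" "snd k"] ik by auto
        then show "{s i<..<t i} \<inter> {s k<..<t k} = {}"
          using st[OF ik(1)] st[OF ik(2)] by (simp add: interior_atLeastAtMost_real)
      qed
      have "(\<Sum>i\<in>pN. t i - s i) \<le> measure lebesgue U"
      proof (rule sum_length_disjoint_intervals_le)
        show "disjoint_family_on (\<lambda>i. {s i<..<t i}) pN"
          using disj by (rule disjoint_family_on_mono[rotated]) (auto simp: pN_def)
        show "{s i<..<t i} \<subseteq> U" if "i \<in> pN" for i
          using fine'[of i] d(2)[of "fst i"] that by (fastforce simp: pN_def)
      qed (use fin st Ulm in \<open>auto simp: pN_def\<close>)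
      then have bad: "(\<Sum>i\<in>pN. norm (f (t i) - f (s i))) < e1"
        using mU st fin by (intro \<delta>(2)[rule_format]) (auto simp: pN_def intro: disjoint_family_on_mono[OF _ disj])
      have "(\<Sum>(x, k)\<in>p. measure lborel k *\<^sub>R g' x) = (\<Sum>i\<in>p. (t i - s i) *\<^sub>R g' (fst i))"
        using st by (intro sum.cong refl) (auto simp: split_beta)
      moreover have "f b - f a = (\<Sum>i\<in>p. f (t i) - f (s i))"
        using additive_tagged_division_1[OF ab pd, of f] by (simp add: s_def t_def split_beta)
      ultimately have "(\<Sum>(x, k)\<in>p. measure lborel k *\<^sub>R g' x) - (f b - f a)
          = (\<Sum>i\<in>p. (t i - s i) *\<^sub>R g' (fst i) - (f (t i) - f (s i)))"
        by (simp add: sum_subtractf)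
      also have "\<dots> = (\<Sum>i\<in>p - pN. (t i - s i) *\<^sub>R g' (fst i) - (f (t i) - f (s i)))
          + (\<Sum>i\<in>pN. (t i - s i) *\<^sub>R g' (fst i) - (f (t i) - f (s i)))"
        using fin by (intro sum.subset_diff) (auto simp: pN_def)
      also have "norm \<dots> \<le> (\<Sum>i\<in>p - pN. e2 * (t i - s i)) + (\<Sum>i\<in>pN. norm (f (t i) - f (s i)))"
      proof (rule norm_triangle_mono)
        show "norm (\<Sum>i\<in>p - pN. (t i - s i) *\<^sub>R g' (fst i) - (f (t i) - f (s i)))
            \<le> (\<Sum>i\<in>p - pN. e2 * (t i - s i))"
          by (intro sum_norm_le good)
        show "norm (\<Sum>i\<in>pN. (t i - s i) *\<^sub>R g' (fst i) - (f (t i) - f (s i)))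
            \<le> (\<Sum>i\<in>pN. norm (f (t i) - f (s i)))"
          by (intro sum_norm_le) (simp add: pN_def g'_def norm_minus_commute)
      qed
      also have "(\<Sum>i\<in>p - pN. e2 * (t i - s i)) \<le> (\<Sum>i\<in>p. e2 * (t i - s i))"
        using fin st e2 by (intro sum_mono2) auto
      also have "\<dots> = e2 * (b - a)"
        using additive_tagged_division_1[OF ab pd, of "\<lambda>x. x"]
        by (simp add: s_def t_def split_beta flip: sum_distrib_left)
      also have "\<dots> \<le> e / 4" using ab e by (simp add: e2_def field_simps)
      finally show "norm ((\<Sum>(x, k)\<in>p. measure lborel k *\<^sub>R g' x) - (f b - f a)) < e"
        using bad e by (simp add: e1_def)
    qed
  qed
  then show ?thesis
    by (rule has_integral_spike[OF N, rotated]) (simp add: g'_def)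
qed


section \<open>Closure properties of absolute continuity\<close>

lemma abs_cont_imp_continuous_on:
  fixes f :: "real \<Rightarrow> 'a::real_normed_vector"
  assumes "abs_cont_on_interval f a b"
  shows "continuous_on {a..b} f"
  unfolding continuous_on_iff
proof (intro ballI allI impI)
  fix x \<epsilon> :: real assume x: "x \<in> {a..b}" and "\<epsilon> > 0"
  then obtain \<delta> where \<delta>: "\<delta> > 0" "\<And>n s t. (\<forall>k<n. a \<le> s k \<and> s k \<le> t k \<and> t k \<le> b) \<and>
      disjoint_family_on (\<lambda>k. {s k<..<t k}) {..<n} \<and> (\<Sum>k<(n::nat). t k - s k) < \<delta> \<longrightarrow>
      (\<Sum>k<n. norm (f (t k) - f (s k))) < \<epsilon>"
    using assms unfolding abs_cont_on_interval_def by blast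
  have "dist (f y) (f x) < \<epsilon>" if "y \<in> {a..b}" "dist y x < \<delta>" for y
  proof -
    have "norm (f (max x y) - f (min x y)) < \<epsilon>"
      using \<delta>(2)[of 1 "\<lambda>_. min x y" "\<lambda>_. max x y"] x that
      by (auto simp: disjoint_family_on_def dist_real_def max_def min_def split: if_splits)
    then show ?thesis
      by (auto simp: dist_norm max_def min_def norm_minus_commute split: if_splits)
  qed
  then show "\<exists>d>0. \<forall>x'\<in>{a..b}. dist x' x < d \<longrightarrow> dist (f x') (f x) < \<epsilon>"
    using \<delta>(1) by blast
qed

text \<open>The common source of the closure properties: control of the increments of
  \<open>h\<close> by those of \<open>f\<close> and \<open>g\<close> carries over to the sums in the
  definition.\<close>

lemma abs_cont_on_interval_dominated:
  fixes f :: "real \<Rightarrow> 'a::real_normed_vector" and g :: "real \<Rightarrow> 'b::real_normed_vector"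
    and h :: "real \<Rightarrow> 'c::real_normed_vector"
  assumes f: "abs_cont_on_interval f a b" and g: "abs_cont_on_interval g a b"
    and dom: "\<And>s t. a \<le> s \<Longrightarrow> s \<le> t \<Longrightarrow> t \<le> b \<Longrightarrow>
      norm (h t - h s) \<le> M * norm (f t - f s) + M * norm (g t - g s)"
  shows "abs_cont_on_interval h a b"
  unfolding abs_cont_on_interval_def
proof (intro allI impI)
  fix \<epsilon> :: real assume \<epsilon>: "\<epsilon> > 0"
  \<comment> \<open>Replacing \<open>M\<close> by a positive number makes the division of \<epsilon>
    legitimate whatever the sign of \<open>M\<close>.\<close>
  define M' where "M' = max M 1"
  have M': "M' > 0" "M \<le> M'" by (auto simp: M'_def)
  have e: "\<epsilon> / (2 * M') > 0" using \<epsilon> M' by simp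
  obtain \<delta>1 where \<delta>1: "\<delta>1 > 0" "\<And>n s t. (\<forall>k<n. a \<le> s k \<and> s k \<le> t k \<and> t k \<le> b) \<and>
      disjoint_family_on (\<lambda>k. {s k<..<t k}) {..<n} \<and> (\<Sum>k<(n::nat). t k - s k) < \<delta>1 \<longrightarrow>
      (\<Sum>k<n. norm (f (t k) - f (s k))) < \<epsilon> / (2 * M')"
    using f e unfolding abs_cont_on_interval_def by blast
  obtain \<delta>2 where \<delta>2: "\<delta>2 > 0" "\<And>n s t. (\<forall>k<n. a \<le> s k \<and> s k \<le> t k \<and> t k \<le> b) \<and>
      disjoint_family_on (\<lambda>k. {s k<..<t k}) {..<n} \<and> (\<Sum>k<(n::nat). t k - s k) < \<delta>2 \<longrightarrow>
      (\<Sum>k<n. norm (g (t k) - g (s k))) < \<epsilon> / (2 * M')"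
    using g e unfolding abs_cont_on_interval_def by blast
  show "\<exists>\<delta>>0. \<forall>n s t. (\<forall>k<n. a \<le> s k \<and> s k \<le> t k \<and> t k \<le> b) \<and>
      disjoint_family_on (\<lambda>k. {s k<..<t k}) {..<n} \<and> (\<Sum>k<(n::nat). t k - s k) < \<delta> \<longrightarrow>
      (\<Sum>k<n. norm (h (t k) - h (s k))) < \<epsilon>"
  proof (intro exI[of _ "min \<delta>1 \<delta>2"] conjI allI impI)
    fix n :: nat and s t :: "nat \<Rightarrow> real"
    assume *: "(\<forall>k<n. a \<le> s k \<and> s k \<le> t k \<and> t k \<le> b) \<and>
      disjoint_family_on (\<lambda>k. {s k<..<t k}) {..<n} \<and> (\<Sum>k<n. t k - s k) < min \<delta>1 \<delta>2"
    have "(\<Sum>k<n. norm (h (t k) - h (s k)))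
      \<le> (\<Sum>k<n. M' * norm (f (t k) - f (s k)) + M' * norm (g (t k) - g (s k)))"
    proof (rule sum_mono)
      fix k assume "k \<in> {..<n}"
      then have "norm (h (t k) - h (s k)) \<le> M * norm (f (t k) - f (s k)) + M * norm (g (t k) - g (s k))"
        using * by (intro dom) auto
      also have "\<dots> \<le> M' * norm (f (t k) - f (s k)) + M' * norm (g (t k) - g (s k))"
        using M'(2) by (intro add_mono mult_right_mono) auto
      finally show "norm (h (t k) - h (s k)) \<le> \<dots>" .
    qed
    also have "\<dots> = M' * (\<Sum>k<n. norm (f (t k) - f (s k))) + M' * (\<Sum>k<n. norm (g (t k) - g (s k)))"
      by (simp add: sum.distrib sum_distrib_left)
    also have "\<dots> < M' * (\<epsilon> / (2 * M')) + M' * (\<epsilon> / (2 * M'))"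
      using * M'(1) \<delta>1(2)[of n s t] \<delta>2(2)[of n s t] by (intro add_strict_mono mult_strict_left_mono) auto
    also have "\<dots> = \<epsilon>" using M'(1) by (simp add: field_simps)
    finally show "(\<Sum>k<n. norm (h (t k) - h (s k))) < \<epsilon>" .
  qed (use \<delta>1(1) \<delta>2(1) in auto)
qed

text \<open>Both factors are continuous, hence bounded on the compact interval, and the increment of
  the product splits into one term for each factor.\<close>

lemma abs_cont_on_interval_bilinear:
  fixes f :: "real \<Rightarrow> 'a::real_normed_vector" and g :: "real \<Rightarrow> 'b::real_normed_vector"
    and h :: "'a \<Rightarrow> 'b \<Rightarrow> 'c::real_normed_vector"
  assumes h: "bounded_bilinear h" and f: "abs_cont_on_interval f a b" and g: "abs_cont_on_interval g a b"
  shows "abs_cont_on_interval (\<lambda>x. h (f x) (g x)) a b"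
proof -
  interpret bounded_bilinear h by fact
  obtain K where K: "K \<ge> 0" "\<And>x y. norm (h x y) \<le> norm x * norm y * K"
    using nonneg_bounded by blast
  have "bounded (f ` {a..b})" "bounded (g ` {a..b})"
    using f g abs_cont_imp_continuous_on by (auto intro!: compact_imp_bounded compact_continuous_image)
  then obtain Bf Bg where B: "\<And>x. x \<in> {a..b} \<Longrightarrow> norm (f x) \<le> Bf" "\<And>x. x \<in> {a..b} \<Longrightarrow> norm (g x) \<le> Bg"
    unfolding bounded_iff by blast
  show ?thesis
  proof (rule abs_cont_on_interval_dominated[OF f g])
    fix s t assume st: "a \<le> s" "s \<le> t" "t \<le> b"
    let ?m = "max Bf Bg"
    have m: "norm (f s) \<le> ?m" "norm (g t) \<le> ?m"
      using B[of s] B[of t] st by (auto simp: le_max_iff_disj)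
    have "h (f t) (g t) - h (f s) (g s) = h (f t - f s) (g t) + h (f s) (g t - g s)"
      by (simp add: diff_left diff_right)
    then have "norm (h (f t) (g t) - h (f s) (g s)) \<le> norm (h (f t - f s) (g t)) + norm (h (f s) (g t - g s))"
      using norm_triangle_ineq by metis
    also have "\<dots> \<le> norm (f t - f s) * norm (g t) * K + norm (f s) * norm (g t - g s) * K"
      by (intro add_mono K)
    also have "\<dots> \<le> norm (f t - f s) * ?m * K + ?m * norm (g t - g s) * K"
      using m K(1) by (intro add_mono mult_right_mono mult_left_mono) auto
    finally show "norm (h (f t) (g t) - h (f s) (g s)) \<le>
        (?m * K) * norm (f t - f s) + (?m * K) * norm (g t - g s)"
      by (simp add: mult_ac)
  qed
qed

lemma abs_cont_on_interval_lipschitz: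
  fixes f :: "real \<Rightarrow> 'a::real_normed_vector"
  assumes f: "abs_cont_on_interval f a b"
    and h: "\<And>x y. x \<in> {a..b} \<Longrightarrow> y \<in> {a..b} \<Longrightarrow> norm (h (f x) - h (f y)) \<le> M * norm (f x - f y)"
  shows "abs_cont_on_interval (\<lambda>x. h (f x)) a b"
proof (rule abs_cont_on_interval_dominated[OF f f])
  fix s t assume st: "a \<le> s" "s \<le> t" "t \<le> b"
  have "norm (h (f t) - h (f s)) \<le> M * norm (f t - f s)" using st by (intro h) auto
  then show "norm (h (f t) - h (f s)) \<le> (M / 2) * norm (f t - f s) + (M / 2) * norm (f t - f s)"
    by simp
qed

lemma abs_cont_on_interval_bounded_linear:
  fixes f :: "real \<Rightarrow> 'a::real_normed_vector"
  assumes h: "bounded_linear h" and f: "abs_cont_on_interval f a b"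
  shows "abs_cont_on_interval (\<lambda>x. h (f x)) a b"
proof -
  interpret bounded_linear h by fact
  obtain K where "\<And>x. norm (h x) \<le> norm x * K" using bounded by blast
  then have "norm (h (f x) - h (f y)) \<le> K * norm (f x - f y)" for x y
    by (metis diff mult.commute)
  then show ?thesis by (intro abs_cont_on_interval_lipschitz[OF f])
qed

text \<open>Truncation at height n: the norm of \<open>g\<close> is at most n plus the excess
  \<open>h n\<close>. The excess has small integral over the whole interval, and the bounded part
  contributes at most n times the total length.\<close>

lemma abs_cont_on_interval_integral:
  fixes g :: "real \<Rightarrow> 'a::euclidean_space"
  assumes g: "g absolutely_integrable_on {a..b}"
  shows "abs_cont_on_interval (\<lambda>x. integral {a..x} g) a b"
  unfolding abs_cont_on_interval_def
proof (intro allI impI)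
  fix \<epsilon> :: real assume \<epsilon>: "\<epsilon> > 0"
  define h where "h n x = max (norm (g x) - real n) 0" for n x
  have habs: "h n absolutely_integrable_on {a..b}" for n
  proof -
    have "(\<lambda>x. norm (g x) - real n) absolutely_integrable_on {a..b}"
      using absolutely_integrable_norm[OF g] by (intro set_integral_diff(1)) (auto simp: comp_def)
    from absolutely_integrable_max_1[OF this, of "\<lambda>_. 0"] show ?thesis
      by (simp add: h_def[abs_def])
  qed
  have hint: "h n integrable_on {a..b}" for n
    using habs by (rule set_lebesgue_integral_eq_integral(1))
  have gn: "(\<lambda>x. norm (g x)) integrable_on {a..b}"
    using g by (simp add: absolutely_integrable_on_def)
  \<comment> \<open>At each point the excess vanishes as soon as n passes the norm of
    \<open>g\<close> there, and that norm is an integrable majorant.\<close>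
  have "(\<lambda>n. integral {a..b} (h n)) \<longlonglongrightarrow> integral {a..b} (\<lambda>x. 0)"
  proof (rule dominated_convergence(2)[OF hint gn])
    show "norm (h n x) \<le> norm (g x)" for n x by (simp add: h_def)
    show "(\<lambda>n. h n x) \<longlonglongrightarrow> 0" for x
    proof (rule tendsto_eventually)
      obtain n0 where "norm (g x) \<le> real n0" using real_arch_simple by blast
      then show "\<forall>\<^sub>F n in sequentially. h n x = 0"
        by (auto simp: eventually_sequentially h_def intro!: exI[of _ n0])
    qed
  qed
  then obtain n where n: "integral {a..b} (h n) < \<epsilon> / 2"
    using order_tendstoD(2)[of _ 0 sequentially "\<epsilon> / 2"] \<epsilon> by (auto simp: eventually_sequentially)
  define \<delta> where "\<delta> = \<epsilon> / (2 * (real n + 1))"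
  have \<delta>: "\<delta> > 0" using \<epsilon> by (simp add: \<delta>_def)
  show "\<exists>\<delta>>0. \<forall>n s t. (\<forall>k<n. a \<le> s k \<and> s k \<le> t k \<and> t k \<le> b) \<and>
      disjoint_family_on (\<lambda>k. {s k<..<t k}) {..<n} \<and> (\<Sum>k<(n::nat). t k - s k) < \<delta> \<longrightarrow>
      (\<Sum>k<n. norm (integral {a..t k} g - integral {a..s k} g)) < \<epsilon>"
  proof (intro exI[of _ \<delta>] conjI \<delta> allI impI)
    fix m :: nat and s t :: "nat \<Rightarrow> real"
    assume *: "(\<forall>k<m. a \<le> s k \<and> s k \<le> t k \<and> t k \<le> b) \<and>
      disjoint_family_on (\<lambda>k. {s k<..<t k}) {..<m} \<and> (\<Sum>k<m. t k - s k) < \<delta>"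
    have sub: "{s k..t k} \<subseteq> {a..b}" if "k < m" for k using * that by auto
    have hsub: "h n integrable_on {s k..t k}" if "k < m" for k
      using integrable_on_subinterval[OF hint sub[OF that]] .
    have "norm (integral {a..t k} g - integral {a..s k} g)
        \<le> integral {s k..t k} (h n) + (t k - s k) * real n" if k: "k < m" for k
    proof -
      have st: "a \<le> s k" "s k \<le> t k" "t k \<le> b" using * k by auto
      have gi: "g integrable_on {a..t k}" "g integrable_on {s k..t k}"
        using set_lebesgue_integral_eq_integral(1)[OF g] st
        by (auto intro: integrable_on_subinterval)
      have "integral {a..t k} g - integral {a..s k} g = integral {s k..t k} g"
        using Henstock_Kurzweil_Integration.integral_combine[OF st(1,2) gi(1)] by (simp add: algebra_simps)
      also have "norm \<dots> \<le> integral {s k..t k} (\<lambda>x. h n x + real n)"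
      proof (rule integral_norm_bound_integral[OF gi(2)])
        show "(\<lambda>x. h n x + real n) integrable_on {s k..t k}"
          using hsub[OF k] by (intro integrable_add) auto
      qed (simp add: h_def)
      also have "\<dots> = integral {s k..t k} (h n) + (t k - s k) * real n"
        using Henstock_Kurzweil_Integration.integral_add[OF hsub[OF k] integrable_const_ivl[of "real n"]] st
        by (simp add: mult.commute)
      finally show ?thesis .
    qed
    then have "(\<Sum>k<m. norm (integral {a..t k} g - integral {a..s k} g))
        \<le> (\<Sum>k<m. integral {s k..t k} (h n) + (t k - s k) * real n)"
      by (intro sum_mono) auto
    also have "\<dots> = (\<Sum>k<m. integral {s k..t k} (h n)) + (\<Sum>k<m. t k - s k) * real n"
      by (simp add: sum.distrib sum_distrib_right)
    also have "(\<Sum>k<m. integral {s k..t k} (h n)) \<le> integral {a..b} (h n)"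
    proof -
      have un: "(h n has_integral (\<Sum>k<m. integral {s k..t k} (h n))) (\<Union>k<m. {s k..t k})"
      proof (rule has_integral_UN)
        \<comment> \<open>Only the open intervals are disjoint by hypothesis; the closed ones may
          also share endpoints, which form a finite set.\<close>
        show "pairwise (\<lambda>k k'. negligible ({s k..t k} \<inter> {s k'..t k'})) {..<m}"
        proof (rule pairwiseI)
          fix k k' assume kk: "k \<in> {..<m}" "k' \<in> {..<m}" "k \<noteq> k'"
          then have "{s k<..<t k} \<inter> {s k'<..<t k'} = {}"
            using * unfolding disjoint_family_on_def by blast
          moreover have "{s k..t k} \<inter> {s k'..t k'} \<subseteq>
              {s k, t k, s k', t k'} \<union> ({s k<..<t k} \<inter> {s k'<..<t k'})"
            by auto
          ultimately show "negligible ({s k..t k} \<inter> {s k'..t k'})"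
            by (metis finite.emptyI finite.insertI negligible_finite negligible_subset sup_bot_right)
        qed
      qed (use hsub in auto)
      moreover have "integral (\<Union>k<m. {s k..t k}) (h n) \<le> integral {a..b} (h n)"
        using un by (intro integral_subset_le hint UN_least sub) (auto simp: h_def)
      ultimately show ?thesis by (simp add: integral_unique)
    qed
    also note n
    also have "(\<Sum>k<m. t k - s k) * real n \<le> \<delta> * real n"
      using * by (intro mult_right_mono) auto
    also have "\<dots> \<le> \<epsilon> / 2" using \<epsilon> by (simp add: \<delta>_def field_simps)
    finally show "(\<Sum>k<m. norm (integral {a..t k} g - integral {a..s k} g)) < \<epsilon>"
      by simp
  qed
qed

text \<open>The library states Lebesgue differentiation with one-sided averages only; the left-hand
  average of \<open>g\<close> is the right-hand average of the reflected function.\<close>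

lemma integral_has_vector_derivative_ae:
  fixes g :: "real \<Rightarrow> 'a::euclidean_space"
  assumes g: "\<And>l. 0 \<le> l \<Longrightarrow> g integrable_on {0..l}"
  obtains N where "negligible N"
    "\<And>x. x \<in> {0..} - N \<Longrightarrow> ((\<lambda>x. integral {0..x} g) has_vector_derivative g x) (at x within {0..})"
proof -
  \<comment> \<open>Extension by zero gives a function integrable on every bounded interval of the
    line, so that reflection stays within the domain.\<close>
  define G where "G x = (if x \<in> {0..} then g x else 0)" for x
  have G: "G integrable_on {a..b}" for a b
  proof -
    have "{0..} \<inter> {a..b} = {max 0 a..b}" by auto
    moreover have "g integrable_on {max 0 a..b}"
    proof (cases "b \<ge> 0")
      case True
      then show ?thesis by (intro integrable_on_subinterval[OF g[OF True]]) auto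
    qed auto
    ultimately show ?thesis
      unfolding G_def integrable_restrict_Int by simp
  qed
  define G' where "G' x = G (- x)" for x
  have G': "G' integrable_on {a..b}" for a b
    using Henstock_Kurzweil_Integration.integrable_reflect_real[of G "-a" "-b"] G[of "-b" "-a"]
    by (simp only: G'_def[abs_def] minus_minus)
  obtain N1 where N1: "negligible N1" "\<And>x e. x \<notin> N1 \<Longrightarrow> 0 < e \<Longrightarrow>
      \<exists>d>0. \<forall>h. 0 < h \<and> h < d \<longrightarrow> norm (integral {x..x + h} G /\<^sub>R h - G x) < e"
    using integrable_ccontinuous_explicit[of G] G by auto
  obtain N2 where N2: "negligible N2" "\<And>x e. x \<notin> N2 \<Longrightarrow> 0 < e \<Longrightarrow>
      \<exists>d>0. \<forall>h. 0 < h \<and> h < d \<longrightarrow> norm (integral {x..x + h} G' /\<^sub>R h - G' x) < e"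
    using integrable_ccontinuous_explicit[of G'] G' by auto
  define F where "F x = integral {0..x} g" for x
  have diff: "F y - F x = integral {x..y} G" if "0 \<le> x" "x \<le> y" for x y
  proof -
    have "integral {0..x} g + integral {x..y} g = integral {0..y} g"
      using that by (intro Henstock_Kurzweil_Integration.integral_combine g) auto
    moreover have "integral {x..y} g = integral {x..y} G"
      using that by (intro integral_cong) (auto simp: G_def)
    ultimately show ?thesis by (simp add: F_def algebra_simps)
  qed
  show thesis
  proof (rule that)
    \<comment> \<open>\<open>N2\<close> belongs to the reflected function, so its points are
      reflected back.\<close>
    show "negligible (N1 \<union> uminus ` N2 \<union> {0})"
      using N1(1) N2(1) by (intro negligible_Un negligible_differentiable_image_negligible)
        (auto intro!: derivative_intros)
    fix x assume x: "x \<in> {0..} - (N1 \<union> uminus ` N2 \<union> {0})"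
    then have x0: "x > 0" and xN: "x \<notin> N1" "- x \<notin> N2" and Gx: "G x = g x" "G' (- x) = g x"
      by (auto simp: G_def G'_def image_iff)
    show "((\<lambda>x. integral {0..x} g) has_vector_derivative g x) (at x within {0..})"
      unfolding has_vector_derivative_def has_derivative_within_alt
    proof (intro conjI allI impI)
      show "bounded_linear (\<lambda>h. h *\<^sub>R g x)" by (rule bounded_linear_scaleR_left)
      fix e :: real assume e: "e > 0"
      obtain d1 where d1: "d1 > 0" "\<And>h. 0 < h \<Longrightarrow> h < d1 \<Longrightarrow> norm (integral {x..x + h} G /\<^sub>R h - g x) < e"
        using N1(2)[OF xN(1) e] Gx by auto
      obtain d2 where d2: "d2 > 0"
          "\<And>h. 0 < h \<Longrightarrow> h < d2 \<Longrightarrow> norm (integral {- x..- x + h} G' /\<^sub>R h - g x) < e"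
        using N2(2)[OF xN(2) e] Gx by auto
      \<comment> \<open>Multiplication by the length \<open>h\<close> turns the estimate for the
        average into the one for the increment that differentiability asks for.\<close>
      have scale: "norm (I - h *\<^sub>R g x) \<le> e * h" if "norm (I /\<^sub>R h - g x) < e" "h > 0" for I h
      proof -
        have "I - h *\<^sub>R g x = h *\<^sub>R (I /\<^sub>R h - g x)" using that(2) by (simp add: scaleR_diff_right)
        then have "norm (I - h *\<^sub>R g x) = h * norm (I /\<^sub>R h - g x)" using that(2) by simp
        also have "\<dots> \<le> h * e" using that by (intro mult_left_mono) auto
        finally show ?thesis by (simp add: mult.commute)
      qed
      have "norm (F y - F x - (y - x) *\<^sub>R g x) \<le> e * norm (y - x)"
        if y: "y \<in> {0..}" "norm (y - x) < min d1 d2" for y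
      proof (cases x y rule: linorder_cases)
        case less
        then have "norm (integral {x..y} G - (y - x) *\<^sub>R g x) \<le> e * (y - x)"
          using scale[OF d1(2)[of "y - x"]] y by simp
        then show ?thesis using diff[of x y] less x0 by simp
      next
        case greater
        have "integral {- x..- y} G' = integral {y..x} G"
          unfolding G'_def by (rule Henstock_Kurzweil_Integration.integral_reflect_real)
        then have "norm (integral {y..x} G - (x - y) *\<^sub>R g x) \<le> e * (x - y)"
          using scale[OF d2(2)[of "x - y"]] y greater by simp
        moreover have "F y - F x - (y - x) *\<^sub>R g x = - (integral {y..x} G - (x - y) *\<^sub>R g x)"
          using diff[of y x] greater y by (simp add: algebra_simps)
        ultimately show ?thesis using greater by (simp only: norm_minus_cancel) simp
      qed simp
      then show "\<exists>d>0. \<forall>y\<in>{0..}. norm (y - x) < d \<longrightarrow>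
          norm (integral {0..y} g - integral {0..x} g - (y - x) *\<^sub>R g x) \<le> e * norm (y - x)"
        using d1(1) d2(1) by (intro exI[of _ "min d1 d2"]) (auto simp: F_def)
    qed
  qed
qed

section \<open>Linear systems with integrable coefficients\<close>

lemma bounded_bilinear_matrix_mult:
  "bounded_bilinear ((**) :: complex^'n^'m \<Rightarrow> complex^'k^'n \<Rightarrow> complex^'k^'m)"
  unfolding bilinear_conv_bounded_bilinear[symmetric] bilinear_def
  by (auto intro!: linearI simp: vec_eq_iff matrix_matrix_mult_def sum.distrib algebra_simps
      scaleR_sum_right)

lemma bounded_bilinear_matrix_vector_mult:
  "bounded_bilinear ((*v) :: complex^'n^'m \<Rightarrow> complex^'n \<Rightarrow> complex^'m)"
  unfolding bilinear_conv_bounded_bilinear[symmetric] bilinear_def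
  by (auto intro!: linearI simp: vec_eq_iff matrix_vector_mult_def sum.distrib algebra_simps
      scaleR_sum_right)

lemma bounded_linear_mat: "bounded_linear (mat :: complex \<Rightarrow> complex^'n^'n)"
  unfolding linear_conv_bounded_linear[symmetric]
  by (auto intro!: linearI simp: vec_eq_iff mat_def)

lemma matrix_mult_mat_left: "(mat c ** A) $ i $ k = c * (A $ i $ k)"
  for A :: "complex^'k^'n"
  by (simp add: matrix_matrix_mult_def mat_def if_distrib [where f="\<lambda>x. x * _"] cong: if_cong)

lemma mat_commute: "A ** (mat c ** B) = mat c ** (A ** B)"
  for A :: "complex^'k^'n" and B :: "complex^'l^'k"
proof -
  have "(A ** (mat c ** B)) $ i $ k = (\<Sum>l\<in>UNIV. A $ i $ l * (mat c ** B) $ l $ k)" for i k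
    by (simp add: matrix_matrix_mult_def)
  then have "(A ** (mat c ** B)) $ i $ k = c * (A ** B) $ i $ k" for i k
    by (simp add: matrix_mult_mat_left) (simp add: matrix_matrix_mult_def sum_distrib_left mult_ac)
  then show ?thesis by (simp add: vec_eq_iff matrix_mult_mat_left)
qed

text \<open>With K the integral of \<open>k\<close>, the function exp (2 K) / 2 has the integrand as
  its derivative almost everywhere. It is absolutely continuous because exp is Lipschitz on the
  bounded range of K. This evaluates the weighted Volterra estimate below.\<close>

lemma exp_integral_has_integral:
  fixes k :: "real \<Rightarrow> real"
  assumes k: "\<And>l. 0 \<le> l \<Longrightarrow> k absolutely_integrable_on {0..l}" and x: "0 \<le> x"
  shows "((\<lambda>t. k t * exp (2 * integral {0..t} k)) has_integral
    (exp (2 * integral {0..x} k) - 1) / 2) {0..x}"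
proof -
  let ?K = "\<lambda>t. integral {0..t} k"
  let ?E = "\<lambda>u. exp (2 * u) / 2 :: real"
  have ki: "k integrable_on {0..l}" if "0 \<le> l" for l
    using k[OF that] by (rule set_lebesgue_integral_eq_integral(1))
  obtain N where N: "negligible N"
    "\<And>t. t \<in> {0..} - N \<Longrightarrow> (?K has_vector_derivative k t) (at t within {0..})"
    using integral_has_vector_derivative_ae[OF ki] by blast
  have K: "abs_cont_on_interval ?K 0 x"
    using k x by (intro abs_cont_on_interval_integral) auto
  have "bounded (?K ` {0..x})"
    using abs_cont_imp_continuous_on[OF K] by (auto intro!: compact_imp_bounded compact_continuous_image)
  then obtain M where M: "\<And>t. t \<in> {0..x} \<Longrightarrow> \<bar>?K t\<bar> \<le> M" unfolding bounded_iff by force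
  have lip: "\<bar>?E u - ?E w\<bar> \<le> exp (2 * M) * \<bar>u - w\<bar>" if "\<bar>u\<bar> \<le> M" "\<bar>w\<bar> \<le> M" for u w
  proof -
    have "norm (?E u - ?E w) \<le> exp (2 * M) * norm (u - w)"
      by (rule field_differentiable_bound[where S="{-M..M}" and f'="\<lambda>u. exp (2 * u)"])
         (use that in \<open>auto intro!: derivative_eq_intros\<close>)
    then show ?thesis by simp
  qed
  have "abs_cont_on_interval (\<lambda>t. ?E (?K t)) 0 x"
    by (rule abs_cont_on_interval_lipschitz[OF K]) (use lip M in auto)
  moreover have "((\<lambda>t. ?E (?K t)) has_vector_derivative k t * exp (2 * ?K t)) (at t within {0..x})"
    if "t \<in> {0..x} - N" for t
  proof -
    have "(?K has_real_derivative k t) (at t within {0..x})"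
      using has_vector_derivative_within_subset[OF N(2)[of t], of "{0..x}"] that
      by (auto simp: has_real_derivative_iff_has_vector_derivative)
    then have "((\<lambda>t. ?E (?K t)) has_real_derivative k t * exp (2 * ?K t)) (at t within {0..x})"
      by (auto intro!: derivative_eq_intros)
    then show ?thesis by (simp add: has_real_derivative_iff_has_vector_derivative)
  qed
  ultimately have "((\<lambda>t. k t * exp (2 * ?K t)) has_integral ?E (?K x) - ?E (?K 0)) {0..x}"
    using x N(1) by (intro abs_cont_has_integral_derivative)
  then show ?thesis by (simp add: diff_divide_distrib)
qed

text \<open>The coefficient is affine in the parameter: \<open>A0\<close> multiplies z and
  \<open>A1\<close> carries the potential. All dependence on z is therefore polynomial at each
  Picard step.\<close>

locale linear_system =
  fixes A0 :: "complex^'n^'n" and A1 :: "real \<Rightarrow> complex^'n^'n"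
  assumes A1: "\<And>l. 0 \<le> l \<Longrightarrow> A1 absolutely_integrable_on {0..l}"
begin

definition sys_mat :: "real \<Rightarrow> complex \<Rightarrow> complex^'n^'n" where
  "sys_mat t z = mat z ** A0 + A1 t"

primrec picard :: "nat \<Rightarrow> real \<Rightarrow> complex \<Rightarrow> complex^'n^'n" where
  "picard 0 = (\<lambda>x z. mat 1)"
| "picard (Suc n) = (\<lambda>x z. mat 1 + integral {0..x} (\<lambda>t. sys_mat t z ** picard n t z))"

text \<open>The limit of the Picard iterates, written as a telescoping series so that the
  Weierstrass M-test applies.\<close>

definition solution :: "real \<Rightarrow> complex \<Rightarrow> complex^'n^'n" where
  "solution x z = mat 1 + (\<Sum>n. picard (Suc n) x z - picard n x z)"

lemma absolutely_integrable_mult_continuous: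
  fixes A :: "real \<Rightarrow> complex^'n^'n" and F :: "real \<Rightarrow> complex^'n^'n"
  assumes A: "\<And>l. 0 \<le> l \<Longrightarrow> A absolutely_integrable_on {0..l}" and F: "continuous_on {0..} F"
  shows "(\<lambda>t. A t ** F t) absolutely_integrable_on {0..l}"
proof (cases "0 \<le> l")
  case True
  have F': "continuous_on {0..l} F" using F by (rule continuous_on_subset) auto
  \<comment> \<open>The product theorem takes the bounded measurable factor first and the integrable
    one second, hence the swapped multiplication.\<close>
  have "bilinear (\<lambda>X Y :: complex^'n^'n. Y ** X)"
    using bounded_bilinear.flip[OF bounded_bilinear_matrix_mult]
    by (simp add: bilinear_conv_bounded_bilinear)
  from absolutely_integrable_bounded_measurable_product[OF this _ _ _ A[OF True], of F]
  show ?thesis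
    using F' by (simp add: continuous_imp_measurable_on_sets_lebesgue compact_imp_bounded
        compact_continuous_image)
qed (simp add: absolutely_integrable_on_def)

lemma sys_mat_absolutely_integrable:
  assumes "0 \<le> l" shows "(\<lambda>t. sys_mat t z) absolutely_integrable_on {0..l}"
  unfolding sys_mat_def using A1[OF assms]
  by (intro set_integral_add(1)) (auto intro!: absolutely_integrable_continuous_real)

lemma integral_mult_continuous:
  fixes A F :: "real \<Rightarrow> complex^'n^'n"
  assumes A: "\<And>l. 0 \<le> l \<Longrightarrow> A absolutely_integrable_on {0..l}" and F: "continuous_on {0..} F"
  shows "continuous_on {0..} (\<lambda>x. integral {0..x} (\<lambda>t. A t ** F t))"
    and "(\<lambda>t. A t ** F t) integrable_on {0..l}"
    and "0 \<le> l \<Longrightarrow> abs_cont_on_interval (\<lambda>x. integral {0..x} (\<lambda>t. A t ** F t)) 0 l"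
proof -
  note abs = absolutely_integrable_mult_continuous[OF A F]
  show int: "(\<lambda>t. A t ** F t) integrable_on {0..l}" for l
    using abs by (rule set_lebesgue_integral_eq_integral(1))
  show ac: "abs_cont_on_interval (\<lambda>x. integral {0..x} (\<lambda>t. A t ** F t)) 0 l" for l
    using abs by (rule abs_cont_on_interval_integral)
  show "continuous_on {0..} (\<lambda>x. integral {0..x} (\<lambda>t. A t ** F t))"
    unfolding continuous_on_eq_continuous_within
  proof
    fix x :: real assume x: "x \<in> {0..}"
    have "continuous_on {0..x+1} (\<lambda>x. integral {0..x} (\<lambda>t. A t ** F t))"
      using abs_cont_imp_continuous_on[OF ac] .
    then have "continuous (at x within {0..x+1}) (\<lambda>x. integral {0..x} (\<lambda>t. A t ** F t))"
      using x by (simp add: continuous_on_eq_continuous_within)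
    \<comment> \<open>Near x the half-line and the bounded interval coincide; the right endpoint
      \<open>x+1\<close> is chosen for this.\<close>
    moreover have "at x within {0..x+1} = at x within {0..}"
      using x by (intro at_within_nhd[of _ "{x-1<..<x+1}"]) auto
    ultimately show "continuous (at x within {0..}) (\<lambda>x. integral {0..x} (\<lambda>t. A t ** F t))"
      by simp
  qed
qed

section \<open>Dependence of the Picard iterates on x and z\<close>

lemma picard_continuous: "continuous_on {0..} (\<lambda>x. picard n x z)"
  by (induction n) (auto intro!: continuous_intros integral_mult_continuous sys_mat_absolutely_integrable)

text \<open>Polynomials in z whose matrix coefficients are continuous in x. The class is preserved
  by the Volterra integral, so the iterates are holomorphic in z without any differentiation under
  the integral sign.\<close>

inductive poly_in_z :: "(real \<Rightarrow> complex \<Rightarrow> complex^'n^'n) \<Rightarrow> bool" where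
  const: "continuous_on {0..} c \<Longrightarrow> poly_in_z (\<lambda>x z. c x)"
| add: "poly_in_z F \<Longrightarrow> poly_in_z G \<Longrightarrow> poly_in_z (\<lambda>x z. F x z + G x z)"
| mult: "poly_in_z F \<Longrightarrow> poly_in_z (\<lambda>x z. mat z ** F x z)"

lemma poly_in_z_continuous:
  "poly_in_z F \<Longrightarrow> continuous_on {0..} (\<lambda>x. F x z)"
  by (induction rule: poly_in_z.induct)
     (auto intro!: continuous_intros bounded_bilinear.continuous_on[OF bounded_bilinear_matrix_mult])

lemma poly_in_z_holomorphic:
  "poly_in_z F \<Longrightarrow> (\<lambda>z. F x z $ i $ k) holomorphic_on UNIV"
  by (induction arbitrary: i k rule: poly_in_z.induct)
     (auto intro!: holomorphic_intros simp: matrix_mult_mat_left)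

text \<open>A coefficient free of z integrates to a continuous coefficient, sums are integrated
  termwise, and \<open>mat z\<close> commutes with \<open>A t\<close> and comes out of the
  integral.\<close>

lemma poly_in_z_integral:
  assumes A: "\<And>l. 0 \<le> l \<Longrightarrow> A absolutely_integrable_on {0..l}"
  shows "poly_in_z F \<Longrightarrow> poly_in_z (\<lambda>x z. integral {0..x} (\<lambda>t. A t ** F t z))"
proof (induction rule: poly_in_z.induct)
  case (const c)
  then show ?case by (intro poly_in_z.const integral_mult_continuous A)
next
  case (add F G)
  have "integral {0..x} (\<lambda>t. A t ** (F t z + G t z)) =
      integral {0..x} (\<lambda>t. A t ** F t z) + integral {0..x} (\<lambda>t. A t ** G t z)" for x z
    unfolding matrix_add_ldistrib
    by (intro Henstock_Kurzweil_Integration.integral_add integral_mult_continuous A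
        poly_in_z_continuous add)
  then show ?case using add.IH by (simp add: poly_in_z.add)
next
  case (mult F)
  have "integral {0..x} (\<lambda>t. A t ** (mat z ** F t z)) = mat z ** integral {0..x} (\<lambda>t. A t ** F t z)" for x z
    unfolding mat_commute
    using integral_linear[OF integral_mult_continuous(2)[OF A poly_in_z_continuous[OF mult.hyps]]
        bounded_bilinear.bounded_linear_right[OF bounded_bilinear_matrix_mult, of "mat z"]]
    by (simp add: comp_def)
  then show ?case using mult.IH by (simp add: poly_in_z.mult)
qed

text \<open>Splitting the coefficient matrix into \<open>mat z ** A0\<close> and \<open>A1 t\<close>
  expresses the next iterate through the three rules of \<open>poly_in_z\<close>.\<close>

lemma picard_poly_in_z: "poly_in_z (picard n)"
proof (induction n)
  case 0
  show ?case by (simp add: poly_in_z.const)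
next
  case (Suc n)
  have A0: "(\<lambda>t. A0) absolutely_integrable_on {0..l}" for l :: real
    by (intro absolutely_integrable_continuous_real) auto
  have "integral {0..x} (\<lambda>t. sys_mat t z ** picard n t z) =
    mat z ** integral {0..x} (\<lambda>t. A0 ** picard n t z) + integral {0..x} (\<lambda>t. A1 t ** picard n t z)" for x z
  proof -
    have 1: "(\<lambda>t. A0 ** picard n t z) integrable_on {0..x}"
      using integral_mult_continuous(2)[OF A0 poly_in_z_continuous[OF Suc]] .
    have 2: "(\<lambda>t. A1 t ** picard n t z) integrable_on {0..x}"
      using integral_mult_continuous(2)[OF A1 poly_in_z_continuous[OF Suc]] .
    note bl = bounded_bilinear.bounded_linear_right[OF bounded_bilinear_matrix_mult, of "mat z"]
    have "integral {0..x} (\<lambda>t. sys_mat t z ** picard n t z) =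
      integral {0..x} (\<lambda>t. mat z ** (A0 ** picard n t z) + A1 t ** picard n t z)"
      by (simp add: sys_mat_def bounded_bilinear.add_left[OF bounded_bilinear_matrix_mult] matrix_mul_assoc)
    also have "\<dots> = integral {0..x} (\<lambda>t. mat z ** (A0 ** picard n t z)) + integral {0..x} (\<lambda>t. A1 t ** picard n t z)"
      using integrable_linear[OF 1 bl] 2
      by (intro Henstock_Kurzweil_Integration.integral_add) (auto simp: comp_def)
    also have "integral {0..x} (\<lambda>t. mat z ** (A0 ** picard n t z)) = mat z ** integral {0..x} (\<lambda>t. A0 ** picard n t z)"
      using integral_linear[OF 1 bl] by (simp add: comp_def)
    finally show ?thesis .
  qed
  moreover have "poly_in_z (\<lambda>x z. mat 1 + (mat z ** integral {0..x} (\<lambda>t. A0 ** picard n t z) +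
      integral {0..x} (\<lambda>t. A1 t ** picard n t z)))"
    by (intro poly_in_z.add poly_in_z.mult poly_in_z_integral A0 A1 Suc poly_in_z.const) auto
  ultimately show ?case by simp
qed

section \<open>Weighted estimates and convergence of the Picard iterates\<close>

lemma sys_mat_bound:
  obtains \<kappa> where "\<And>t. 0 \<le> \<kappa> t" "\<And>l. 0 \<le> l \<Longrightarrow> \<kappa> absolutely_integrable_on {0..l}"
    "\<And>t z X :: complex^'n^'n. norm z \<le> R \<Longrightarrow> norm (sys_mat t z ** X) \<le> \<kappa> t * norm X"
proof -
  obtain K where K: "K \<ge> 0" "\<And>X (Y :: complex^'n^'n). norm ((X :: complex^'n^'n) ** Y) \<le> norm X * norm Y * K"
    using bounded_bilinear.nonneg_bounded[OF bounded_bilinear_matrix_mult] by blast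
  have "bounded_linear (\<lambda>z. mat z ** A0)"
    using bounded_linear_compose[OF bounded_bilinear.bounded_linear_left[OF bounded_bilinear_matrix_mult]
        bounded_linear_mat] .
  then obtain C where C: "C \<ge> 0" "\<And>z. norm (mat z ** A0) \<le> norm z * C"
    using bounded_linear.nonneg_bounded by blast
  \<comment> \<open>\<open>K\<close> bounds the matrix product and \<open>C\<close> the map sending
    z to \<open>mat z ** A0\<close>. The absolute value of \<open>R\<close> keeps \<kappa>
    nonnegative even for negative \<open>R\<close>, when no z satisfies the bound.\<close>
  define \<kappa> where "\<kappa> t = (\<bar>R\<bar> * C + norm (A1 t)) * K" for t
  show thesis
  proof (rule that[of \<kappa>])
    show "0 \<le> \<kappa> t" for t using K C by (simp add: \<kappa>_def)
    show "\<kappa> absolutely_integrable_on {0..l}" if "0 \<le> l" for l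
      unfolding \<kappa>_def
      using absolutely_integrable_norm[OF A1[OF that]]
      by (intro set_integrable_mult_left impI set_integral_add(1))
         (auto intro!: absolutely_integrable_continuous_real simp: comp_def)
    fix t :: real and z :: complex and X :: "complex^'n^'n" assume z: "norm z \<le> R"
    have "norm (sys_mat t z) \<le> norm (mat z ** A0) + norm (A1 t)"
      unfolding sys_mat_def by (rule norm_triangle_ineq)
    also have "\<dots> \<le> \<bar>R\<bar> * C + norm (A1 t)"
      using C(2)[of z] mult_right_mono[OF _ C(1), of "norm z" "\<bar>R\<bar>"] z by linarith
    finally have "norm (sys_mat t z) * norm X * K \<le> (\<bar>R\<bar> * C + norm (A1 t)) * norm X * K"
      using K(1) by (intro mult_right_mono) auto
    then show "norm (sys_mat t z ** X) \<le> \<kappa> t * norm X"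
      using K(2)[of "sys_mat t z" X] by (simp add: \<kappa>_def mult_ac)
  qed
qed

text \<open>In the weighted norm \<open>sup exp (- 2 \<integral>\<kappa>) |F|\<close> the Volterra operator has norm at most 1/2.\<close>

lemma volterra_contraction:
  obtains E where "\<And>t. 0 \<le> t \<Longrightarrow> 1 \<le> E t" "\<And>s t. 0 \<le> s \<Longrightarrow> s \<le> t \<Longrightarrow> E s \<le> E t"
    "\<And>x z c (F :: real \<Rightarrow> complex^'n^'n). norm z \<le> R \<Longrightarrow> 0 \<le> x \<Longrightarrow> 0 \<le> c \<Longrightarrow> continuous_on {0..} F \<Longrightarrow>
      (\<And>t. 0 \<le> t \<Longrightarrow> t \<le> x \<Longrightarrow> norm (F t) \<le> c * E t) \<Longrightarrow>
      norm (integral {0..x} (\<lambda>t. sys_mat t z ** F t)) \<le> c / 2 * E x"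
proof -
  obtain \<kappa> where \<kappa>: "\<And>t. 0 \<le> \<kappa> t" "\<And>l. 0 \<le> l \<Longrightarrow> \<kappa> absolutely_integrable_on {0..l}"
    "\<And>t z X :: complex^'n^'n. norm z \<le> R \<Longrightarrow> norm (sys_mat t z ** X) \<le> \<kappa> t * norm X"
    using sys_mat_bound[of R] by blast
  have \<kappa>i: "\<kappa> integrable_on {0..l}" if "0 \<le> l" for l
    using \<kappa>(2)[OF that] by (rule set_lebesgue_integral_eq_integral(1))
  define E where "E t = exp (2 * integral {0..t} \<kappa>)" for t
  show thesis
  proof (rule that[of E])
    show "1 \<le> E t" if "0 \<le> t" for t
      using integral_nonneg[OF \<kappa>i[OF that]] \<kappa>(1) by (simp add: E_def)
    show "E s \<le> E t" if "0 \<le> s" "s \<le> t" for s t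
      using that \<kappa>(1) by (auto simp: E_def intro!: integral_subset_le \<kappa>i)
    fix x c :: real and z :: complex and F :: "real \<Rightarrow> complex^'n^'n"
    assume z: "norm z \<le> R" and x: "0 \<le> x" and c: "0 \<le> c" and F: "continuous_on {0..} F"
      and le: "\<And>t. 0 \<le> t \<Longrightarrow> t \<le> x \<Longrightarrow> norm (F t) \<le> c * E t"
    \<comment> \<open>The factor 2 in the exponent of \<open>E\<close> is what produces the
      contraction constant 1/2.\<close>
    have hi: "((\<lambda>t. c * (\<kappa> t * E t)) has_integral c * ((E x - 1) / 2)) {0..x}"
      unfolding E_def by (intro has_integral_mult_right exp_integral_has_integral \<kappa>(2) x)
    have "norm (integral {0..x} (\<lambda>t. sys_mat t z ** F t)) \<le> integral {0..x} (\<lambda>t. c * (\<kappa> t * E t))"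
    proof (rule integral_norm_bound_integral)
      show "(\<lambda>t. sys_mat t z ** F t) integrable_on {0..x}"
        by (intro integral_mult_continuous sys_mat_absolutely_integrable F)
      show "(\<lambda>t. c * (\<kappa> t * E t)) integrable_on {0..x}" using hi by blast
      fix t assume t: "t \<in> {0..x}"
      have "norm (sys_mat t z ** F t) \<le> \<kappa> t * norm (F t)" using \<kappa>(3)[OF z] .
      also have "\<dots> \<le> \<kappa> t * (c * E t)" using t by (intro mult_left_mono le \<kappa>(1)) auto
      finally show "norm (sys_mat t z ** F t) \<le> c * (\<kappa> t * E t)" by (simp add: mult_ac)
    qed
    also have "\<dots> = c * ((E x - 1) / 2)" using hi by (rule integral_unique)
    also have "\<dots> \<le> c / 2 * E x" using c by (simp add: algebra_simps)
    finally show "norm (integral {0..x} (\<lambda>t. sys_mat t z ** F t)) \<le> c / 2 * E x" .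
  qed
qed

text \<open>Each step applies the Volterra operator to the previous difference and so halves its
  weighted norm. On the bounded interval the weight is at most \<open>E l\<close>, which gives a
  geometric bound uniform in x and z.\<close>

lemma picard_diff_bound:
  assumes "0 \<le> l"
  obtains C where "C \<ge> 0" "\<And>n x z. x \<in> {0..l} \<Longrightarrow> norm z \<le> R \<Longrightarrow>
     norm (picard (Suc n) x z - picard n x z) \<le> C * (1 / 2) ^ n"
proof -
  obtain E where E: "\<And>t. 0 \<le> t \<Longrightarrow> 1 \<le> E t" "\<And>s t. 0 \<le> s \<Longrightarrow> s \<le> t \<Longrightarrow> E s \<le> E t"
    "\<And>x z c (F :: real \<Rightarrow> complex^'n^'n). norm z \<le> R \<Longrightarrow> 0 \<le> x \<Longrightarrow> 0 \<le> c \<Longrightarrow> continuous_on {0..} F \<Longrightarrow>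
      (\<And>t. 0 \<le> t \<Longrightarrow> t \<le> x \<Longrightarrow> norm (F t) \<le> c * E t) \<Longrightarrow>
      norm (integral {0..x} (\<lambda>t. sys_mat t z ** F t)) \<le> c / 2 * E x"
    using volterra_contraction[of R] by blast
  define c where "c = norm (mat 1 :: complex^'n^'n)"
  have c0: "c \<ge> 0" by (simp add: c_def)
  have *: "norm (picard (Suc n) x z - picard n x z) \<le> c * (1 / 2) ^ n * E x" if "0 \<le> x" "norm z \<le> R" for n x z
    using that(1)
  proof (induction n arbitrary: x)
    case 0
    \<comment> \<open>The constant function \<open>mat 1\<close> has weighted norm at most
      \<open>c\<close> because \<open>E\<close> is at least 1.\<close>
    have "norm (integral {0..x} (\<lambda>t. sys_mat t z ** mat 1)) \<le> c / 2 * E x"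
      using E(3)[OF that(2) 0 c0, of "\<lambda>_. mat 1"] E(1) by (simp add: c_def mult_le_cancel_left1)
    also have "\<dots> \<le> c * E x" using c0 E(1)[OF 0] by (intro mult_right_mono) auto
    finally show ?case by simp
  next
    case (Suc n)
    let ?D = "\<lambda>t. picard (Suc n) t z - picard n t z"
    have "picard (Suc (Suc n)) x z - picard (Suc n) x z =
      integral {0..x} (\<lambda>t. sys_mat t z ** picard (Suc n) t z) - integral {0..x} (\<lambda>t. sys_mat t z ** picard n t z)"
      by simp
    also have "\<dots> = integral {0..x} (\<lambda>t. sys_mat t z ** picard (Suc n) t z - sys_mat t z ** picard n t z)"
      by (intro Henstock_Kurzweil_Integration.integral_diff[symmetric] integral_mult_continuous
          sys_mat_absolutely_integrable picard_continuous)
    also have "\<dots> = integral {0..x} (\<lambda>t. sys_mat t z ** ?D t)"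
      by (simp only: bounded_bilinear.diff_right[OF bounded_bilinear_matrix_mult])
    also have "norm \<dots> \<le> (c * (1 / 2) ^ n) / 2 * E x"
      using Suc.IH c0 by (intro E(3) that Suc.prems continuous_intros picard_continuous) auto
    finally show ?case by simp
  qed
  show thesis
  proof (rule that[of "c * E l"])
    show "0 \<le> c * E l" using c0 E(1)[OF assms] by simp
    fix n :: nat and x :: real and z :: complex assume x: "x \<in> {0..l}" and z: "norm z \<le> R"
    have "norm (picard (Suc n) x z - picard n x z) \<le> c * (1 / 2) ^ n * E x"
      using x z by (intro *) auto
    also have "\<dots> \<le> c * (1 / 2) ^ n * E l" using x c0 by (intro mult_left_mono E(2)) auto
    finally show "norm (picard (Suc n) x z - picard n x z) \<le> c * E l * (1 / 2) ^ n"
      by (simp add: mult_ac)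
  qed
qed

text \<open>Uniformity holds jointly in x and z: fixing x yields holomorphy of the limit in z,
  fixing z yields continuity in x.\<close>

lemma picard_uniform_limit:
  assumes "0 \<le> l"
  shows "uniform_limit ({0..l} \<times> cball 0 R) (\<lambda>n (x, z). picard n x z) (\<lambda>(x, z). solution x z) sequentially"
proof -
  obtain C where C: "C \<ge> 0" "\<And>n x z. x \<in> {0..l} \<Longrightarrow> norm z \<le> R \<Longrightarrow>
     norm (picard (Suc n) x z - picard n x z) \<le> C * (1 / 2) ^ n"
    using picard_diff_bound[OF assms, of R] by blast
  let ?f = "\<lambda>n p. picard (Suc n) (fst p) (snd p) - picard n (fst p) (snd p)"
  have "uniform_limit ({0..l} \<times> cball 0 R) (\<lambda>n p. \<Sum>i<n. ?f i p) (\<lambda>p. \<Sum>i. ?f i p) sequentially"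
    by (rule Weierstrass_m_test[of _ _ "\<lambda>n. C * (1 / 2) ^ n"])
       (use C(2) in \<open>auto intro!: summable_mult summable_geometric simp del: picard.simps\<close>)
  then have "uniform_limit ({0..l} \<times> cball 0 R) (\<lambda>n p. mat 1 + (\<Sum>i<n. ?f i p))
      (\<lambda>p. mat 1 + (\<Sum>i. ?f i p)) sequentially"
    by (intro uniform_limit_intros)
  moreover have "mat 1 + (\<Sum>i<n. ?f i p) = picard n (fst p) (snd p)" for n p
    by (subst sum_lessThan_telescope) simp
  ultimately show ?thesis
    by (simp only: solution_def case_prod_unfold)
qed

section \<open>Regularity of the limit and the differential equation\<close>

lemma solution_holomorphic:
  assumes "0 \<le> x"
  shows "(\<lambda>z. solution x z $ i $ k) holomorphic_on UNIV"
proof (rule holomorphic_uniform_sequence[where f="\<lambda>n z. picard n x z $ i $ k"])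
  show "(\<lambda>z. picard n x z $ i $ k) holomorphic_on UNIV" for n
    using poly_in_z_holomorphic[OF picard_poly_in_z] .
  fix w :: complex
  have "uniform_limit (cball w 1) (\<lambda>n z. picard n x z) (\<lambda>z. solution x z) sequentially"
  proof (rule uniform_limitI)
    fix e :: real assume "e > 0"
    from uniform_limitD[OF picard_uniform_limit[OF assms, of "norm w + 1"] this]
    have "\<forall>\<^sub>F n in sequentially. \<forall>z\<in>cball 0 (norm w + 1). dist (picard n x z) (solution x z) < e"
      by eventually_elim (use assms in auto)
    moreover have "cball w 1 \<subseteq> cball 0 (norm w + 1)"
      by (auto simp: dist_norm) (metis add.commute add_left_mono norm_minus_commute norm_triangle_sub order_trans)
    ultimately show "\<forall>\<^sub>F n in sequentially. \<forall>z\<in>cball w 1. dist (picard n x z) (solution x z) < e"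
      by (auto elim!: eventually_mono)
  qed
  then have "uniform_limit (cball w 1) (\<lambda>n z. picard n x z $ i $ k) (\<lambda>z. solution x z $ i $ k) sequentially"
    by (intro bounded_linear.uniform_limit[OF bounded_linear_vec_nth] )
  then show "\<exists>d>0. cball w d \<subseteq> UNIV \<and>
      uniform_limit (cball w d) (\<lambda>n z. picard n x z $ i $ k) (\<lambda>z. solution x z $ i $ k) sequentially"
    by (intro exI[of _ 1]) auto
qed auto

lemma solution_continuous: "continuous_on {0..} (\<lambda>x. solution x z)"
  unfolding continuous_on_eq_continuous_within
proof
  fix x :: real assume x: "x \<in> {0..}"
  have "continuous_on {0..x+1} (\<lambda>x. solution x z)"
  proof (rule uniform_limit_theorem[where f="\<lambda>n x. picard n x z" and F=sequentially])
    show "\<forall>\<^sub>F n in sequentially. continuous_on {0..x+1} (\<lambda>x. picard n x z)"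
      by (intro always_eventually allI continuous_on_subset[OF picard_continuous]) auto
    show "uniform_limit {0..x+1} (\<lambda>n x. picard n x z) (\<lambda>x. solution x z) sequentially"
    proof (rule uniform_limitI)
      fix e :: real assume e: "e > 0"
      have "0 \<le> x + 1" using x by simp
      from uniform_limitD[OF picard_uniform_limit[OF this, of "norm z"] e]
      show "\<forall>\<^sub>F n in sequentially. \<forall>y\<in>{0..x+1}. dist (picard n y z) (solution y z) < e"
        by eventually_elim auto
    qed
  qed auto
  then have "continuous (at x within {0..x+1}) (\<lambda>x. solution x z)"
    using x by (simp add: continuous_on_eq_continuous_within)
  moreover have "at x within {0..x+1} = at x within {0..}"
    using x by (intro at_within_nhd[of _ "{x-1<..<x+1}"]) auto
  ultimately show "continuous (at x within {0..}) (\<lambda>x. solution x z)" by simp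
qed

text \<open>Passage to the limit in the Picard recursion; the weighted estimate, applied to the
  difference of iterate and limit, shows that the integrals converge.\<close>

lemma solution_integral_equation:
  assumes x: "0 \<le> x"
  shows "solution x z = mat 1 + integral {0..x} (\<lambda>t. sys_mat t z ** solution t z)"
proof -
  obtain E where E: "\<And>t. 0 \<le> t \<Longrightarrow> 1 \<le> E t"
    "\<And>x w c (F :: real \<Rightarrow> complex^'n^'n). norm w \<le> norm z \<Longrightarrow> 0 \<le> x \<Longrightarrow> 0 \<le> c \<Longrightarrow> continuous_on {0..} F \<Longrightarrow>
      (\<And>t. 0 \<le> t \<Longrightarrow> t \<le> x \<Longrightarrow> norm (F t) \<le> c * E t) \<Longrightarrow>
      norm (integral {0..x} (\<lambda>t. sys_mat t w ** F t)) \<le> c / 2 * E x"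
    by (rule volterra_contraction[of "norm z"]) blast
  note ul = picard_uniform_limit[OF x, of "norm z"]
  have lim: "(\<lambda>n. picard n x z) \<longlonglongrightarrow> solution x z"
    using tendsto_uniform_limitI[OF ul, of "(x, z)"] x by simp
  have "(\<lambda>n. integral {0..x} (\<lambda>t. sys_mat t z ** picard n t z)) \<longlonglongrightarrow> integral {0..x} (\<lambda>t. sys_mat t z ** solution t z)"
  proof (rule LIMSEQ_I)
    fix e :: real assume e: "e > 0"
    \<comment> \<open>A uniform error \<open>d\<close> in the iterate changes the integral by at
      most \<open>d / 2 * E x\<close>, which is e/2.\<close>
    define d where "d = e / E x"
    have d: "d > 0" using e E(1)[OF x] by (simp add: d_def)
    from uniform_limitD[OF ul d]
    have "\<forall>\<^sub>F n in sequentially. \<forall>t\<in>{0..x}. dist (picard n t z) (solution t z) < d"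
      by eventually_elim auto
    then obtain N where N: "\<And>n t. n \<ge> N \<Longrightarrow> t \<in> {0..x} \<Longrightarrow> dist (picard n t z) (solution t z) < d"
      unfolding eventually_sequentially by blast
    have "norm (integral {0..x} (\<lambda>t. sys_mat t z ** picard n t z) - integral {0..x} (\<lambda>t. sys_mat t z ** solution t z)) < e"
      if n: "n \<ge> N" for n
    proof -
      have "integral {0..x} (\<lambda>t. sys_mat t z ** picard n t z) - integral {0..x} (\<lambda>t. sys_mat t z ** solution t z)
        = integral {0..x} (\<lambda>t. sys_mat t z ** picard n t z - sys_mat t z ** solution t z)"
        by (intro Henstock_Kurzweil_Integration.integral_diff[symmetric] integral_mult_continuous
          sys_mat_absolutely_integrable picard_continuous solution_continuous)
      also have "\<dots> = integral {0..x} (\<lambda>t. sys_mat t z ** (picard n t z - solution t z))"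
        by (simp only: bounded_bilinear.diff_right[OF bounded_bilinear_matrix_mult])
      also have "norm \<dots> \<le> d / 2 * E x"
      proof (intro E(2) x continuous_intros picard_continuous solution_continuous)
        fix t assume t: "0 \<le> t" "t \<le> x"
        have "norm (picard n t z - solution t z) \<le> d" using N[OF n, of t] t by (simp add: dist_norm)
        also have "\<dots> \<le> d * E t" using d E(1)[OF t(1)] by simp
        finally show "norm (picard n t z - solution t z) \<le> d * E t" .
      qed (use d in auto)
      also have "\<dots> < e" using e E(1)[OF x] by (simp add: d_def)
      finally show ?thesis .
    qed
    then show "\<exists>N. \<forall>n\<ge>N. norm (integral {0..x} (\<lambda>t. sys_mat t z ** picard n t z) -
        integral {0..x} (\<lambda>t. sys_mat t z ** solution t z)) < e" by blast
  qed
  then have "(\<lambda>n. picard (Suc n) x z) \<longlonglongrightarrow> mat 1 + integral {0..x} (\<lambda>t. sys_mat t z ** solution t z)"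
    by (auto intro!: tendsto_intros)
  with LIMSEQ_Suc[OF lim] show ?thesis by (rule LIMSEQ_unique)
qed

lemma solution_derivative:
  obtains N where "negligible N"
    "\<And>x. x \<in> {0..} - N \<Longrightarrow>
      ((\<lambda>x. solution x z) has_vector_derivative sys_mat x z ** solution x z) (at x within {0..})"
proof -
  let ?g = "\<lambda>t. sys_mat t z ** solution t z"
  have "?g integrable_on {0..l}" for l
    by (intro integral_mult_continuous sys_mat_absolutely_integrable solution_continuous)
  from integral_has_vector_derivative_ae[OF this]
  obtain N where N: "negligible N" "\<And>x. x \<in> {0..} - N \<Longrightarrow>
      ((\<lambda>x. integral {0..x} ?g) has_vector_derivative ?g x) (at x within {0..})"
    by blast
  show thesis
  proof (rule that[OF N(1)])
    fix x assume x: "x \<in> {0..} - N"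
    have "((\<lambda>x. mat 1 + integral {0..x} ?g) has_vector_derivative ?g x) (at x within {0..})"
      using N(2)[OF x] by (auto intro!: derivative_eq_intros)
    then show "((\<lambda>x. solution x z) has_vector_derivative ?g x) (at x within {0..})"
      by (rule has_vector_derivative_transform[rotated 2]) (use x solution_integral_equation in auto)
  qed
qed

lemma solution_abs_cont:
  assumes "0 \<le> l" shows "abs_cont_on_interval (\<lambda>x. solution x z) 0 l"
proof -
  have "abs_cont_on_interval (\<lambda>x. integral {0..x} (\<lambda>t. sys_mat t z ** solution t z)) 0 l"
    using assms by (intro integral_mult_continuous sys_mat_absolutely_integrable solution_continuous)
  from abs_cont_on_interval_dominated[OF this this, of "\<lambda>x. solution x z" 1] show ?thesis
    by (simp add: solution_integral_equation)
qed

lemma solution_0: "solution 0 z = mat 1"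
  using solution_integral_equation[of 0 z] by simp

end

section \<open>The fundamental solution of the Dirac system\<close>

lemma matrix_inv_cancel:
  fixes A :: "'a::field^'n^'n"
  assumes "invertible A" shows "A ** matrix_inv A = mat 1" "matrix_inv A ** A = mat 1"
  using someI_ex[OF assms[unfolded invertible_def]] unfolding matrix_inv_def by auto

lemma det_holomorphic:
  fixes A :: "complex \<Rightarrow> complex^'n^'n"
  assumes "\<And>i k. (\<lambda>z. A z $ i $ k) holomorphic_on S"
  shows "(\<lambda>z. det (A z)) holomorphic_on S"
  unfolding det_def by (intro holomorphic_intros assms)

lemma matrix_vector_mult_axis: "(A *v axis k 1) $ i = A $ i $ k"
  for A :: "complex^'n^'m"
  by (simp add: matrix_vector_mult_def axis_def if_distrib[where f="\<lambda>x. _ * x"] cong: if_cong)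

text \<open>Cramer's rule writes every entry of the inverse as a quotient of two determinants, which
  are polynomials in holomorphic entries.\<close>

lemma matrix_inv_holomorphic:
  fixes A :: "complex \<Rightarrow> complex^'n^'n"
  assumes hol: "\<And>i k. (\<lambda>z. A z $ i $ k) holomorphic_on S" and inv: "\<And>z. z \<in> S \<Longrightarrow> invertible (A z)"
  shows "(\<lambda>z. matrix_inv (A z) $ i $ k) holomorphic_on S"
proof -
  \<comment> \<open>Column i is replaced by the k-th unit vector, because column k of the inverse
    solves the system with that right-hand side.\<close>
  let ?D = "\<lambda>z. (\<chi> r c. if c = i then (axis k 1 :: complex^'n) $ r else A z $ r $ c) :: complex^'n^'n"
  have D: "(\<lambda>z. det (?D z) / det (A z)) holomorphic_on S"
  proof (intro holomorphic_intros det_holomorphic hol)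
    show "(\<lambda>z. ?D z $ r $ c) holomorphic_on S" for r c
      using hol by (cases "c = i") auto
    show "det (A z) \<noteq> 0" if "z \<in> S" for z
      using inv[OF that] by (simp add: invertible_det_nz)
  qed
  have "matrix_inv (A z) $ i $ k = det (?D z) / det (A z)" if z: "z \<in> S" for z
  proof -
    have "A z *v (matrix_inv (A z) *v axis k 1) = axis k 1"
      by (simp add: matrix_vector_mul_assoc matrix_inv_cancel[OF inv[OF z]])
    moreover have "det (A z) \<noteq> 0" using inv[OF z] by (simp add: invertible_det_nz)
    ultimately have "matrix_inv (A z) *v axis k 1 = (\<chi> i. det (\<chi> r c. if c = i then (axis k 1 :: complex^'n) $ r else A z $ r $ c) / det (A z))"
      using cramer by blast
    then have "(matrix_inv (A z) *v axis k 1) $ i = det (?D z) / det (A z)" by simp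
    then show ?thesis by (simp add: matrix_vector_mult_axis)
  qed
  with D show ?thesis by (simp cong: holomorphic_cong)
qed

lemma matrix_mult_holomorphic:
  fixes A :: "complex \<Rightarrow> complex^'n^'m" and B :: "complex \<Rightarrow> complex^'k^'n"
  assumes "\<And>i k. (\<lambda>z. A z $ i $ k) holomorphic_on S" "\<And>i k. (\<lambda>z. B z $ i $ k) holomorphic_on S"
  shows "(\<lambda>z. (A z ** B z) $ i $ k) holomorphic_on S"
  unfolding matrix_matrix_mult_def by (simp, intro holomorphic_intros assms)

section \<open>Adjoints, block vectors and the indefinite form\<close>

lemma mat_adj_mult: "mat_adj (A ** B) = mat_adj B ** mat_adj A"
  for A :: "complex^'n^'m" and B :: "complex^'k^'n"
  by (simp add: vec_eq_iff mat_adj_def matrix_matrix_mult_def mult.commute)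

lemma mat_adj_mat_adj: "mat_adj (mat_adj A) = A"
  by (simp add: vec_eq_iff mat_adj_def)

lemma mat_adj_add: "mat_adj (A + B) = mat_adj A + mat_adj B"
  by (simp add: vec_eq_iff mat_adj_def)

lemma mat_adj_diff: "mat_adj (A - B) = mat_adj A - mat_adj B"
  by (simp add: vec_eq_iff mat_adj_def)

lemma mat_adj_mat: "mat_adj (mat c) = mat (cnj c)"
  by (simp add: vec_eq_iff mat_adj_def mat_def)

text \<open>On complex vectors \<open>\<bullet>\<close> is the real part of the Hermitian product,
  so the conjugate transpose is the adjoint with respect to it. All quadratic forms below are
  handled through this real inner product.\<close>

lemma inner_mat_adj: "(A *v x) \<bullet> y = x \<bullet> (mat_adj A *v y)"
  for A :: "complex^'n^'m"
proof -
  have "(A *v x) \<bullet> y = (\<Sum>i\<in>UNIV. \<Sum>k\<in>UNIV. (A $ i $ k * x $ k) \<bullet> (y $ i))"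
    by (simp add: inner_vec_def matrix_vector_mult_def inner_sum_left)
  also have "\<dots> = (\<Sum>k\<in>UNIV. \<Sum>i\<in>UNIV. (A $ i $ k * x $ k) \<bullet> (y $ i))"
    by (rule sum.swap)
  also have "\<dots> = (\<Sum>k\<in>UNIV. \<Sum>i\<in>UNIV. (x $ k) \<bullet> (cnj (A $ i $ k) * y $ i))"
    by (simp add: inner_complex_def algebra_simps)
  also have "\<dots> = x \<bullet> (mat_adj A *v y)"
    by (simp add: inner_vec_def matrix_vector_mult_def inner_sum_right mat_adj_def)
  finally show ?thesis .
qed

lemma Re_quad_form: "Re (quad_form A x) = x \<bullet> (A *v x)"
  by (simp add: quad_form_def inner_vec_def inner_complex_def)

lemma sum_UNIV_Plus:
  fixes f :: "'a::finite + 'b::finite \<Rightarrow> 'c::comm_monoid_add"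
  shows "(\<Sum>i\<in>UNIV. f i) = (\<Sum>i\<in>UNIV. f (Inl i)) + (\<Sum>i\<in>UNIV. f (Inr i))"
  unfolding UNIV_Plus_UNIV[symmetric] by (subst sum.Plus) auto

text \<open>The entry type is arbitrary. Since a matrix is a vector of rows, the same operation
  joins two column vectors and also stacks two matrices, as in [I; \<phi>].\<close>

definition vjoin :: "'a^'m1 \<Rightarrow> 'a^'m2 \<Rightarrow> 'a^('m1 + 'm2)" where
  "vjoin a b = (\<chi> i. case i of Inl k \<Rightarrow> a $ k | Inr k \<Rightarrow> b $ k)"

lemma vjoin_nth [simp]: "vjoin a b $ Inl k = a $ k" "vjoin a b $ Inr l = b $ l"
  by (auto simp: vjoin_def)

lemma vec_sum_eq_iff: "x = y \<longleftrightarrow> (\<forall>k. x $ Inl k = y $ Inl k) \<and> (\<forall>l. x $ Inr l = y $ Inr l)"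
  for x y :: "'a^('m1::finite + 'm2::finite)"
  by (simp add: vec_eq_iff split_sum_all)

lemma vjoin_cases: obtains a b where "y = vjoin a b"
proof
  show "y = vjoin (\<chi> k. y $ Inl k) (\<chi> l. y $ Inr l)" by (simp add: vec_sum_eq_iff)
qed

lemma vjoin_diff: "vjoin a b - vjoin c d = vjoin (a - c) (b - d)"
  for a c :: "'a::ab_group_add^'m1" and b d :: "'a^'m2"
  by (simp add: vec_sum_eq_iff)

lemma vjoin_zero: "vjoin 0 0 = 0"
  by (simp add: vec_sum_eq_iff)

lemma inner_vjoin: "vjoin a b \<bullet> vjoin c d = a \<bullet> c + b \<bullet> d"
  by (simp add: inner_vec_def sum_UNIV_Plus)

lemma matrix_vector_mult_vjoin: "vjoin A B *v f = vjoin (A *v f) (B *v f)"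
  for A :: "complex^'n^'m1" and B :: "complex^'n^'m2"
  by (simp add: vec_sum_eq_iff matrix_vector_mult_def)

lemma sig_j_vjoin: "sig_j *v vjoin a b = vjoin a (- b)"
  by (simp add: vec_sum_eq_iff matrix_vector_mult_def sum_UNIV_Plus sig_j_def four_block_def
      row_block_def mat_def if_distrib[where f="\<lambda>x. x * _"] sum_negf cong: if_cong)

lemma row_block_vjoin:
  "row_block (mat 1) 0 *v vjoin a b = a" "row_block 0 (mat 1) *v vjoin a b = b"
  for a :: "complex^'m1" and b :: "complex^'m2"
  by (simp_all add: vec_eq_iff matrix_vector_mult_def sum_UNIV_Plus
      row_block_def mat_def if_distrib[where f="\<lambda>x. x * _"] cong: if_cong)

lemma mat_adj_sig_j: "mat_adj sig_j = sig_j"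
  by (simp add: vec_sum_eq_iff mat_adj_def sig_j_def four_block_def row_block_def mat_def)

lemma mat_adj_pot_V: "mat_adj (pot_V w) = pot_V w"
  by (simp add: vec_sum_eq_iff mat_adj_def pot_V_def four_block_def row_block_def)

lemma sig_j_sig_j: "sig_j ** sig_j = mat 1"
  unfolding matrix_eq
proof
  fix y :: "complex^('a + 'b)"
  show "(sig_j ** sig_j) *v y = mat 1 *v y"
    by (cases y rule: vjoin_cases) (simp add: matrix_vector_mul_assoc[symmetric] sig_j_vjoin)
qed

text \<open>The Hermitian form y* j y; the real inner product loses nothing because j is Hermitian
  and the form is real.\<close>

definition j_form :: "complex^('m1::finite + 'm2::finite) \<Rightarrow> real" where
  "j_form y = y \<bullet> (sig_j *v y)"

lemma j_form_vjoin: "j_form (vjoin a b) = (norm a)\<^sup>2 - (norm b)\<^sup>2"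
  by (simp add: j_form_def sig_j_vjoin inner_vjoin power2_norm_eq_inner)

lemma norm_vjoin: "(norm (vjoin a b))\<^sup>2 = (norm a)\<^sup>2 + (norm b)\<^sup>2"
  for a :: "complex^'m1" and b :: "complex^'m2"
  by (simp only: power2_norm_eq_inner inner_vjoin)

lemma j_form_lower: "- (norm y)\<^sup>2 \<le> j_form y"
  by (cases y rule: vjoin_cases) (simp add: j_form_vjoin norm_vjoin)

section \<open>The bracket w* j u of two solutions\<close>

definition dirac_mat :: "complex \<Rightarrow> complex^'m2^'m1 \<Rightarrow> complex^('m1 + 'm2)^('m1 + 'm2)" where
  "dirac_mat z w = mat \<i> ** (mat z ** sig_j + sig_j ** pot_V w)"

lemma mat_mult_mat: "mat a ** mat b = (mat (a * b) :: complex^'n^'n)"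
  by (simp add: vec_eq_iff matrix_mult_mat_left) (simp add: mat_def)

lemma mat_vector_mult: "(mat c *v y) $ i = c * (y $ i)"
  for y :: "complex^'n"
  by (simp add: matrix_vector_mult_def mat_def if_distrib[where f="\<lambda>x. x * _"] cong: if_cong)

text \<open>As j squares to the identity, what remains is a scalar matrix plus i times the Hermitian
  matrix V.\<close>

lemma sig_j_dirac_mat: "sig_j ** dirac_mat z w = mat (\<i> * z) + mat \<i> ** pot_V w"
  for w :: "complex^'b^'a"
proof -
  have "sig_j ** dirac_mat z w = mat \<i> ** (sig_j ** (mat z ** sig_j) + sig_j ** (sig_j ** pot_V w))"
    unfolding dirac_mat_def mat_commute[of sig_j "\<i>"] matrix_add_ldistrib[of sig_j] ..
  also have "sig_j ** (mat z ** sig_j) = (mat z :: complex^('a + 'b)^('a + 'b))"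
    by (simp only: mat_commute[of sig_j] sig_j_sig_j matrix_mul_rid)
  also have "sig_j ** (sig_j ** pot_V w) = pot_V w"
    by (simp only: matrix_mul_assoc sig_j_sig_j matrix_mul_lid)
  finally show ?thesis by (simp only: matrix_add_ldistrib mat_mult_mat)
qed

text \<open>The matrix i V is skew-Hermitian, so the potential cancels in the sum and a scalar
  matrix is left.\<close>

lemma dirac_mat_adj:
  "mat_adj (dirac_mat \<zeta> w) ** sig_j + sig_j ** dirac_mat z w = mat (\<i> * (z - cnj \<zeta>))"
proof -
  have "mat_adj (dirac_mat \<zeta> w) ** sig_j = mat_adj (sig_j ** dirac_mat \<zeta> w)"
    by (simp add: mat_adj_mult mat_adj_sig_j)
  also have "\<dots> = mat (- \<i> * cnj \<zeta>) + pot_V w ** mat (- \<i>)"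
    by (simp add: sig_j_dirac_mat mat_adj_add mat_adj_mult mat_adj_mat mat_adj_pot_V)
  also have "pot_V w ** mat (- \<i>) = mat (- \<i>) ** pot_V w"
    using mat_commute[of "pot_V w" "- \<i>" "mat 1"] by simp
  finally show ?thesis
    by (simp add: sig_j_dirac_mat vec_eq_iff matrix_mult_mat_left) (simp add: mat_def algebra_simps)
qed

lemma dirac_bracket_derivative:
  "(dirac_mat \<zeta> p *v w) \<bullet> (sig_j *v y) + w \<bullet> (sig_j *v (dirac_mat z p *v y))
    = w \<bullet> (mat (\<i> * (z - cnj \<zeta>)) *v y)"
proof -
  have "(dirac_mat \<zeta> p *v w) \<bullet> (sig_j *v y) + w \<bullet> (sig_j *v (dirac_mat z p *v y))
      = w \<bullet> ((mat_adj (dirac_mat \<zeta> p) ** sig_j + sig_j ** dirac_mat z p) *v y)"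
    by (simp only: inner_mat_adj matrix_vector_mul_assoc inner_add_right matrix_vector_mult_add_rdistrib)
  then show ?thesis by (simp only: dirac_mat_adj)
qed

lemma is_fundamental_solutionD:
  assumes "is_fundamental_solution v z u"
  shows "u 0 = mat 1" "0 \<le> l \<Longrightarrow> abs_cont_on_interval u 0 l"
    and "\<exists>N. negligible N \<and> (\<forall>x\<in>{0..} - N.
      (u has_vector_derivative dirac_mat z (v x) ** u x) (at x within {0..}))"
proof -
  show "u 0 = mat 1" "0 \<le> l \<Longrightarrow> abs_cont_on_interval u 0 l"
    using assms by (auto simp: is_fundamental_solution_def)
  have "AE x in lebesgue_on {0..}. (u has_vector_derivative dirac_mat z (v x) ** u x) (at x within {0..})"
    using assms by (simp add: is_fundamental_solution_def dirac_mat_def)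
  then have "AE x in lebesgue. x \<in> {0..} \<longrightarrow>
      (u has_vector_derivative dirac_mat z (v x) ** u x) (at x within {0..})"
    by (simp add: AE_restrict_space_iff)
  then show "\<exists>N. negligible N \<and> (\<forall>x\<in>{0..} - N.
      (u has_vector_derivative dirac_mat z (v x) ** u x) (at x within {0..}))"
    unfolding eventually_ae_filter negligible_iff_null_sets by auto
qed

lemma is_fundamental_solutionI:
  assumes "u 0 = mat 1" "\<And>l. 0 \<le> l \<Longrightarrow> abs_cont_on_interval u 0 l" "negligible N"
    and "\<And>x. x \<in> {0..} - N \<Longrightarrow> (u has_vector_derivative dirac_mat z (v x) ** u x) (at x within {0..})"
  shows "is_fundamental_solution v z u"
proof -
  have "AE x in lebesgue. x \<in> {0..} \<longrightarrow>
      (u has_vector_derivative dirac_mat z (v x) ** u x) (at x within {0..})"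
    using assms(3,4) unfolding eventually_ae_filter negligible_iff_null_sets by blast
  then have "AE x in lebesgue_on {0..}. (u has_vector_derivative dirac_mat z (v x) ** u x) (at x within {0..})"
    by (simp add: AE_restrict_space_iff)
  then show ?thesis
    using assms(1,2) by (simp add: is_fundamental_solution_def dirac_mat_def)
qed

text \<open>The bracket is absolutely continuous and its derivative is free of the potential. For
  \<zeta> = \<open>cnj z\<close> the integrand vanishes and the bracket is constant; for \<zeta> = z
  the scalar is -2 Im z and the energy identity results.\<close>

lemma dirac_bracket_has_integral:
  fixes v :: "real \<Rightarrow> complex^'m2^'m1"
  assumes u: "is_fundamental_solution v z u" and w: "is_fundamental_solution v \<zeta> w" and l: "0 \<le> l"
  shows "((\<lambda>t. (w t *v h) \<bullet> (mat (\<i> * (z - cnj \<zeta>)) *v (u t *v g))) has_integral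
    (w l *v h) \<bullet> (sig_j *v (u l *v g)) - h \<bullet> (sig_j *v g)) {0..l}"
proof -
  obtain Nu where Nu: "negligible Nu" "\<And>x. x \<in> {0..} - Nu \<Longrightarrow>
      (u has_vector_derivative dirac_mat z (v x) ** u x) (at x within {0..})"
    using is_fundamental_solutionD(3)[OF u] by blast
  obtain Nw where Nw: "negligible Nw" "\<And>x. x \<in> {0..} - Nw \<Longrightarrow>
      (w has_vector_derivative dirac_mat \<zeta> (v x) ** w x) (at x within {0..})"
    using is_fundamental_solutionD(3)[OF w] by blast
  note blv = bounded_bilinear.bounded_linear_left[OF bounded_bilinear_matrix_vector_mult]
  note brv = bounded_bilinear.bounded_linear_right[OF bounded_bilinear_matrix_vector_mult]
  let ?B = "\<lambda>t. (w t *v h) \<bullet> (sig_j *v (u t *v g))"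
  have "abs_cont_on_interval ?B 0 l"
    using is_fundamental_solutionD(2)[OF u l] is_fundamental_solutionD(2)[OF w l]
    by (intro abs_cont_on_interval_bilinear[OF bounded_bilinear_inner]
        abs_cont_on_interval_bounded_linear[OF blv] abs_cont_on_interval_bounded_linear[OF brv])
  moreover have "(?B has_vector_derivative (w x *v h) \<bullet> (mat (\<i> * (z - cnj \<zeta>)) *v (u x *v g))) (at x within {0..l})"
    if x: "x \<in> {0..l} - (Nu \<union> Nw)" for x
  proof -
    have "(u has_vector_derivative dirac_mat z (v x) ** u x) (at x within {0..l})"
      using x by (intro has_vector_derivative_within_subset[OF Nu(2)]) auto
    then have du: "((\<lambda>t. sig_j *v (u t *v g)) has_vector_derivative
        sig_j *v ((dirac_mat z (v x) ** u x) *v g)) (at x within {0..l})"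
      by (intro bounded_linear.has_vector_derivative[OF brv] bounded_linear.has_vector_derivative[OF blv])
    have "(w has_vector_derivative dirac_mat \<zeta> (v x) ** w x) (at x within {0..l})"
      using x by (intro has_vector_derivative_within_subset[OF Nw(2)]) auto
    then have dw: "((\<lambda>t. w t *v h) has_vector_derivative (dirac_mat \<zeta> (v x) ** w x) *v h) (at x within {0..l})"
      by (intro bounded_linear.has_vector_derivative[OF blv])
    have "(?B has_vector_derivative (w x *v h) \<bullet> (sig_j *v ((dirac_mat z (v x) ** u x) *v g)) +
        ((dirac_mat \<zeta> (v x) ** w x) *v h) \<bullet> (sig_j *v (u x *v g))) (at x within {0..l})"
      by (rule bounded_bilinear.has_vector_derivative[OF bounded_bilinear_inner dw du])
    also have "(w x *v h) \<bullet> (sig_j *v ((dirac_mat z (v x) ** u x) *v g)) +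
        ((dirac_mat \<zeta> (v x) ** w x) *v h) \<bullet> (sig_j *v (u x *v g)) =
        (w x *v h) \<bullet> (mat (\<i> * (z - cnj \<zeta>)) *v (u x *v g))"
      using dirac_bracket_derivative[of \<zeta> "v x" "w x *v h" "u x *v g" z]
      by (simp add: matrix_vector_mul_assoc[symmetric] add.commute)
    finally show ?thesis .
  qed
  ultimately have "((\<lambda>t. (w t *v h) \<bullet> (mat (\<i> * (z - cnj \<zeta>)) *v (u t *v g))) has_integral ?B l - ?B 0) {0..l}"
    using l Nu(1) Nw(1) by (intro abs_cont_has_integral_derivative[where N="Nu \<union> Nw"]) auto
  then show ?thesis
    by (simp add: is_fundamental_solutionD(1)[OF u] is_fundamental_solutionD(1)[OF w])
qed

lemma fundamental_solution_j_unitary: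
  fixes v :: "real \<Rightarrow> complex^'m2^'m1"
  assumes u: "is_fundamental_solution v z u" and w: "is_fundamental_solution v (cnj z) w" and l: "0 \<le> l"
  shows "mat_adj (w l) ** sig_j ** u l = sig_j"
  unfolding matrix_eq
proof
  fix g
  let ?d = "(mat_adj (w l) ** sig_j ** u l) *v g - sig_j *v g"
  have "h \<bullet> ?d = 0" for h
  proof -
    have "((\<lambda>t. 0) has_integral (w l *v h) \<bullet> (sig_j *v (u l *v g)) - h \<bullet> (sig_j *v g)) {0..l}"
      using dirac_bracket_has_integral[OF u w l, of h g]
      by (simp add: mat_0 bounded_bilinear.zero_left[OF bounded_bilinear_matrix_vector_mult])
    then have "(w l *v h) \<bullet> (sig_j *v (u l *v g)) - h \<bullet> (sig_j *v g) = 0"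
      using has_integral_unique has_integral_0 by blast
    then show ?thesis
      by (simp add: inner_mat_adj matrix_vector_mul_assoc[symmetric] inner_diff_right)
  qed
  \<comment> \<open>The difference is orthogonal to every vector, in particular to itself.\<close>
  from this[of ?d] show "(mat_adj (w l) ** sig_j ** u l) *v g = sig_j *v g"
    by simp
qed

lemma fundamental_solution_inverse:
  assumes "is_fundamental_solution v z u" "is_fundamental_solution v (cnj z) w" "0 \<le> l"
  shows "(sig_j ** mat_adj (w l) ** sig_j) ** u l = mat 1"
  using arg_cong[OF fundamental_solution_j_unitary[OF assms], of "\<lambda>A. sig_j ** A"]
  by (simp add: matrix_mul_assoc sig_j_sig_j)

text \<open>Uniqueness comes from the bracket instead of a Gronwall estimate: \<open>u l\<close> and
  \<open>u' l\<close> are both inverse to the same square matrix, built from a solution at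
  \<open>cnj z\<close>.\<close>

lemma fundamental_solution_unique:
  assumes u: "is_fundamental_solution v z u" and u': "is_fundamental_solution v z u'"
    and w: "is_fundamental_solution v (cnj z) w" and l: "0 \<le> l"
  shows "u l = u' l"
proof -
  let ?A = "sig_j ** mat_adj (w l) ** sig_j"
  have 1: "?A ** u l = mat 1" "?A ** u' l = mat 1"
    using fundamental_solution_inverse[OF u w l] fundamental_solution_inverse[OF u' w l] by auto
  then have "u l ** ?A = mat 1" using matrix_left_right_inverse by blast
  then show ?thesis using 1 by (metis matrix_mul_assoc matrix_mul_lid matrix_mul_rid)
qed

text \<open>The energy identity: the bracket of a solution with itself, where both parameters equal
  z.\<close>

lemma j_form_fundamental_solution:
  fixes v :: "real \<Rightarrow> complex^'m2^'m1"
  assumes u: "is_fundamental_solution v z u" and l: "0 \<le> l"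
  shows "(\<lambda>t. (norm (u t *v g))\<^sup>2) integrable_on {0..l}"
    and "j_form (u l *v g) = j_form g - 2 * Im z * integral {0..l} (\<lambda>t. (norm (u t *v g))\<^sup>2)"
proof -
  have "continuous_on {0..l} (\<lambda>t. u t *v g)"
    using abs_cont_imp_continuous_on[OF is_fundamental_solutionD(2)[OF u l]]
    by (rule bounded_linear.continuous_on[OF
      bounded_bilinear.bounded_linear_left[OF bounded_bilinear_matrix_vector_mult]])
  then show int: "(\<lambda>t. (norm (u t *v g))\<^sup>2) integrable_on {0..l}"
    by (intro integrable_continuous_real continuous_intros)
  have eq: "y \<bullet> (mat (\<i> * (z - cnj z)) *v y) = - 2 * Im z * (norm y)\<^sup>2" for y :: "complex^('m1 + 'm2)"
  proof -
    have "\<i> * (z - cnj z) = of_real (- 2 * Im z)" by (simp add: complex_eq_iff)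
    moreover have "mat (of_real r) *v y = r *\<^sub>R y" for r
      unfolding vec_eq_iff vector_scaleR_component mat_vector_mult by (simp add: scaleR_conv_of_real)
    ultimately show ?thesis by (simp only: inner_scaleR_right power2_norm_eq_inner)
  qed
  have "((\<lambda>t. - 2 * Im z * (norm (u t *v g))\<^sup>2) has_integral j_form (u l *v g) - j_form g) {0..l}"
    using dirac_bracket_has_integral[OF u u l, of g g] unfolding eq j_form_def .
  then have "integral {0..l} (\<lambda>t. - 2 * Im z * (norm (u t *v g))\<^sup>2) = j_form (u l *v g) - j_form g"
    by (rule integral_unique)
  then show "j_form (u l *v g) = j_form g - 2 * Im z * integral {0..l} (\<lambda>t. (norm (u t *v g))\<^sup>2)"
    by simp
qed

lemma fund_sol_properties:
  fixes v :: "real \<Rightarrow> complex^'m2^'m1"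
  assumes v: "\<And>l. 0 \<le> l \<Longrightarrow> v absolutely_integrable_on {0..l}"
  shows "is_fundamental_solution v z (\<lambda>x. fund_sol v x z)"
    and "0 \<le> x \<Longrightarrow> (\<lambda>z. fund_sol v x z $ i $ k) holomorphic_on UNIV"
proof -
  let ?L = "\<lambda>w :: complex^'m2^'m1. mat \<i> ** (sig_j ** pot_V w)"
  have "linear (pot_V :: complex^'m2^'m1 \<Rightarrow> _)"
    by (auto intro!: linearI simp: vec_sum_eq_iff pot_V_def four_block_def row_block_def mat_adj_def)
  then have "bounded_linear (pot_V :: complex^'m2^'m1 \<Rightarrow> _)" by (simp add: linear_conv_bounded_linear)
  then have "bounded_linear ?L"
    by (intro bounded_linear_compose[OF bounded_bilinear.bounded_linear_right[OF bounded_bilinear_matrix_mult]])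
  then have "(\<lambda>t. ?L (v t)) absolutely_integrable_on {0..l}" if "0 \<le> l" for l
    using absolutely_integrable_linear[OF v[OF that]] by (simp add: comp_def)
  then interpret linear_system "mat \<i> ** sig_j :: complex^('m1 + 'm2)^('m1 + 'm2)" "\<lambda>t. ?L (v t)"
    by unfold_locales
  \<comment> \<open>With \<open>mat \<i> ** sig_j\<close> as the coefficient of z, the abstract
    system is the Dirac system.\<close>
  have B: "sys_mat t z = dirac_mat z (v t)" for t z
    by (simp add: sys_mat_def dirac_mat_def matrix_add_ldistrib mat_commute[of "mat z"])
  have sol: "is_fundamental_solution v z (\<lambda>x. solution x z)" for z
  proof -
    obtain N where "negligible N" "\<And>x. x \<in> {0..} - N \<Longrightarrow>
      ((\<lambda>x. solution x z) has_vector_derivative sys_mat x z ** solution x z) (at x within {0..})"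
      using solution_derivative[of z] by blast
    then show ?thesis
      unfolding B by (intro is_fundamental_solutionI[where N=N] solution_0 solution_abs_cont)
  qed
  show fs: "is_fundamental_solution v z (\<lambda>x. fund_sol v x z)" for z
    using someI[where P="is_fundamental_solution v z", OF sol] by (simp add: fund_sol_def)
  assume x: "0 \<le> x"
  \<comment> \<open>By uniqueness the function picked by the choice operator agrees with the Picard
    limit, from which it inherits analyticity in z.\<close>
  have "fund_sol v x z = solution x z" for z
    using fundamental_solution_unique[OF fs sol sol x] .
  then show "(\<lambda>z. fund_sol v x z $ i $ k) holomorphic_on UNIV"
    using solution_holomorphic[OF x] by simp
qed

section \<open>Weyl sets\<close>

lemma pos_semidef_conjugate_sig_j:
  fixes M :: "complex^'m1^('m1 + 'm2::finite)"
  shows "pos_semidef (mat_adj M ** sig_j ** M) \<longleftrightarrow> (\<forall>f. 0 \<le> j_form (M *v f))"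
proof -
  have "mat_adj (mat_adj M ** sig_j ** M) = mat_adj M ** sig_j ** M"
    by (simp add: mat_adj_mult mat_adj_mat_adj mat_adj_sig_j matrix_mul_assoc)
  moreover have "f \<bullet> ((mat_adj M ** sig_j ** M) *v f) = j_form (M *v f)" for f
    by (simp add: j_form_def inner_mat_adj matrix_vector_mul_assoc[symmetric])
  ultimately show ?thesis by (simp add: pos_semidef_def Re_quad_form)
qed

text \<open>The quadratic form of the Gram matrix at f is the squared norm of \<open>M *v f\<close>,
  which is positive off 0 exactly when \<open>M\<close> is injective.\<close>

lemma pos_def_gram:
  fixes M :: "complex^'m1^'n"
  shows "pos_def (mat_adj M ** M) \<longleftrightarrow> (\<forall>f. M *v f = 0 \<longrightarrow> f = 0)"
proof -
  have "mat_adj (mat_adj M ** M) = mat_adj M ** M"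
    by (simp add: mat_adj_mult mat_adj_mat_adj)
  moreover have "f \<bullet> ((mat_adj M ** M) *v f) = (norm (M *v f))\<^sup>2" for f
    by (simp add: power2_norm_eq_inner inner_mat_adj matrix_vector_mul_assoc[symmetric])
  ultimately show ?thesis by (auto simp: pos_def_def Re_quad_form)
qed

text \<open>A constant parameter is analytic everywhere, so the two inequalities for one matrix
  settle all z at once.\<close>

lemma exceptional_set_const:
  fixes M :: "complex^'m1^('m1 + 'm2::finite)"
  assumes "\<And>f. M *v f = 0 \<Longrightarrow> f = 0" "\<And>f. 0 \<le> j_form (M *v f)"
  shows "exceptional_set (\<lambda>_. M) = {}" "nonsingular_property_j (\<lambda>_. M)"
proof -
  show "exceptional_set (\<lambda>_. M) = {}"
    using assms by (auto simp: exceptional_set_def pos_def_gram pos_semidef_conjugate_sig_j)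
  then show "nonsingular_property_j (\<lambda>_. M)"
    by (auto simp: nonsingular_property_j_def)
qed

lemma not_exceptionalD:
  fixes P :: "complex \<Rightarrow> complex^'m1^('m1 + 'm2::finite)"
  assumes "z \<in> \<complex>\<^sub>+" "z \<notin> exceptional_set P"
  shows "P z *v f = 0 \<Longrightarrow> f = 0" "0 \<le> j_form (P z *v f)"
  using assms by (auto simp: exceptional_set_def pos_def_gram pos_semidef_conjugate_sig_j)

lemma tendsto_vjoin:
  fixes a b :: "'i \<Rightarrow> complex^_"
  assumes "(a \<longlongrightarrow> a') F" "(b \<longlongrightarrow> b') F"
  shows "((\<lambda>n. vjoin (a n) (b n)) \<longlongrightarrow> vjoin a' b') F"
proof (rule vec_tendstoI)
  show "((\<lambda>n. vjoin (a n) (b n) $ i) \<longlongrightarrow> vjoin a' b' $ i) F" for i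
    using assms by (cases i) (auto intro: tendsto_vec_nth)
qed

locale dirac_system =
  fixes v :: "real \<Rightarrow> complex^'m2^'m1"
  assumes summable_v: "\<And>l. 0 \<le> l \<Longrightarrow> v absolutely_integrable_on {0..l}"
begin

abbreviation U :: "real \<Rightarrow> complex \<Rightarrow> complex^('m1 + 'm2)^('m1 + 'm2)" where
  "U \<equiv> fund_sol v"

lemmas fundamental = fund_sol_properties(1)[OF summable_v]

section \<open>Invertibility of the fundamental solution and monotonicity of the form\<close>

lemma U_0: "U 0 z = mat 1"
  using is_fundamental_solutionD(1)[OF fundamental] .

lemma U_invertible: "0 \<le> x \<Longrightarrow> invertible (U x z)"
  using fundamental_solution_inverse[OF fundamental fundamental] invertible_left_inverse by blast

lemma j_form_U:
  assumes "0 \<le> x"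
  shows "j_form (U x z *v g) = j_form g - 2 * Im z * integral {0..x} (\<lambda>t. (norm (U t z *v g))\<^sup>2)"
  using j_form_fundamental_solution(2)[OF fundamental assms] .

lemma norm_U_integrable: "0 \<le> x \<Longrightarrow> (\<lambda>t. (norm (U t z *v g))\<^sup>2) integrable_on {0..x}"
  using j_form_fundamental_solution(1)[OF fundamental] .

text \<open>The integral subtracted in the energy identity has a nonnegative integrand and, in the
  upper half-plane, a positive factor. This is what makes the Weyl sets nested.\<close>

lemma j_form_U_antimono:
  assumes "z \<in> \<complex>\<^sub>+" "0 \<le> x" "x \<le> y"
  shows "j_form (U y z *v g) \<le> j_form (U x z *v g)"
proof -
  have "integral {0..x} (\<lambda>t. (norm (U t z *v g))\<^sup>2) \<le> integral {0..y} (\<lambda>t. (norm (U t z *v g))\<^sup>2)"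
    using assms by (intro integral_subset_le norm_U_integrable) auto
  then have "2 * Im z * integral {0..x} (\<lambda>t. (norm (U t z *v g))\<^sup>2) \<le>
      2 * Im z * integral {0..y} (\<lambda>t. (norm (U t z *v g))\<^sup>2)"
    using assms(1) by (intro mult_left_mono) (auto simp: upper_half_plane_def)
  then show ?thesis using assms by (simp add: j_form_U)
qed

lemma j_form_U_le:
  assumes "z \<in> \<complex>\<^sub>+" "0 \<le> x"
  shows "j_form (U x z *v g) \<le> j_form g"
  using j_form_U_antimono[OF assms(1) order_refl assms(2)] by (simp add: U_0)

text \<open>If the upper block of \<open>w\<close>, the image of \<open>P z *v f\<close> under the
  inverse of \<open>U x z\<close>, vanishes, the form at \<open>w\<close> is at most 0. The form at
  \<open>P z *v f\<close> is nonnegative and not larger than that at \<open>w\<close>, so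
  \<open>w\<close> is 0 and then f is 0.\<close>

lemma weyl_denom_invertible:
  fixes P :: "complex \<Rightarrow> complex^'m1^('m1 + 'm2)"
  assumes x: "0 \<le> x" and z: "z \<in> \<complex>\<^sub>+" and P: "z \<notin> exceptional_set P"
  shows "invertible (weyl_denom v x z P)"
proof -
  have "f = 0" if f: "weyl_denom v x z P *v f = 0" for f
  proof -
    define w where "w = matrix_inv (U x z) *v (P z *v f)"
    obtain a b where w: "w = vjoin a b" by (rule vjoin_cases)
    have "row_block (mat 1) 0 *v w = 0"
      using f by (simp add: weyl_denom_def w_def matrix_vector_mul_assoc matrix_mul_assoc)
    then have "a = 0" by (simp add: w row_block_vjoin)
    have Uw: "U x z *v w = P z *v f"
      by (simp add: w_def matrix_vector_mul_assoc matrix_mul_assoc matrix_inv_cancel[OF U_invertible[OF x]])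
    have "0 \<le> j_form w"
      using not_exceptionalD(2)[OF z P] j_form_U_le[OF z x, of w] unfolding Uw by (rule order_trans)
    then have "b = 0" by (simp add: w \<open>a = 0\<close> j_form_vjoin)
    then have "P z *v f = 0" using Uw w \<open>a = 0\<close> by (simp add: vjoin_zero)
    then show "f = 0" by (rule not_exceptionalD(1)[OF z P])
  qed
  then show ?thesis
    using matrix_left_invertible_ker[of "weyl_denom v x z P"] by (auto simp: invertible_left_inverse)
qed

text \<open>For the converse inclusion, the parameter \<open>P\<close> may be taken constant.\<close>

lemma weyl_set_iff:
  assumes x: "0 \<le> x" and z: "z \<in> \<complex>\<^sub>+"
  shows "\<phi> \<in> weyl_set v x z \<longleftrightarrow> (\<forall>f. 0 \<le> j_form (U x z *v vjoin f (\<phi> *v f)))"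
proof
  assume "\<phi> \<in> weyl_set v x z"
  then obtain P where \<phi>: "\<phi> = weyl_phi v x z P" and P: "z \<notin> exceptional_set P"
    by (auto simp: weyl_set_def)
  let ?D = "weyl_denom v x z P"
  note D = matrix_inv_cancel[OF weyl_denom_invertible[OF x z P]]
  show "\<forall>f. 0 \<le> j_form (U x z *v vjoin f (\<phi> *v f))"
  proof
    fix f
    \<comment> \<open>Applying the inverse denominator normalizes the upper block of
      \<open>w\<close> to f; the lower block then becomes \<open>\<phi> *v f\<close>.\<close>
    define g where "g = matrix_inv ?D *v f"
    define w where "w = matrix_inv (U x z) *v (P z *v g)"
    obtain a b where w: "w = vjoin a b" by (rule vjoin_cases)
    have "row_block (mat 1) 0 *v w = (?D ** matrix_inv ?D) *v f"
      by (simp add: weyl_denom_def w_def g_def matrix_vector_mul_assoc matrix_mul_assoc)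
    then have a: "a = f" using D by (simp add: w row_block_vjoin)
    have "row_block 0 (mat 1) *v w = \<phi> *v f"
      by (simp add: \<phi> weyl_phi_def w_def g_def matrix_vector_mul_assoc matrix_mul_assoc)
    then have b: "b = \<phi> *v f" by (simp add: w row_block_vjoin)
    have "U x z *v w = P z *v g"
      by (simp add: w_def matrix_vector_mul_assoc matrix_mul_assoc matrix_inv_cancel[OF U_invertible[OF x]])
    then show "0 \<le> j_form (U x z *v vjoin f (\<phi> *v f))"
      using not_exceptionalD(2)[OF z P, of g] by (simp add: w a b)
  qed
next
  assume pos: "\<forall>f. 0 \<le> j_form (U x z *v vjoin f (\<phi> *v f))"
  \<comment> \<open>With this value the inverse of \<open>U x z\<close> takes \<open>M\<close> back
    to [I; \<phi>]: the denominator is the identity and the quotient is \<phi>.\<close>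
  define M where "M = U x z ** vjoin (mat 1) \<phi>"
  have M: "M *v f = U x z *v vjoin f (\<phi> *v f)" for f
    by (simp add: M_def matrix_vector_mul_assoc[symmetric] matrix_vector_mult_vjoin)
  have invM: "matrix_inv (U x z) ** M = vjoin (mat 1) \<phi>"
    by (simp add: M_def matrix_mul_assoc matrix_inv_cancel[OF U_invertible[OF x]])
  have "f = 0" if "M *v f = 0" for f
  proof -
    have "vjoin (mat 1) \<phi> *v f = matrix_inv (U x z) *v (M *v f)"
      by (simp add: matrix_vector_mul_assoc invM)
    then have "vjoin f (\<phi> *v f) = 0" using that by (simp add: matrix_vector_mult_vjoin)
    then show "f = 0" by (simp add: vec_sum_eq_iff) (simp add: vec_eq_iff)
  qed
  note const = exceptional_set_const[of M, OF this, unfolded M, OF _ pos[rule_format]]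
  have D: "weyl_denom v x z (\<lambda>_. M) = mat 1"
    by (simp add: weyl_denom_def matrix_eq matrix_mul_assoc[symmetric] invM)
       (simp add: matrix_vector_mul_assoc[symmetric] matrix_vector_mult_vjoin row_block_vjoin)
  have "matrix_inv (mat 1 :: complex^'m1^'m1) = mat 1"
    using matrix_inv_cancel(1)[of "mat 1 :: complex^'m1^'m1"] by (simp add: invertible_def) 
  then have "weyl_phi v x z (\<lambda>_. M) = \<phi>"
    by (simp add: weyl_phi_def D matrix_eq matrix_mul_assoc[symmetric] invM)
       (simp add: matrix_vector_mul_assoc[symmetric] matrix_vector_mult_vjoin row_block_vjoin)
  then show "\<phi> \<in> weyl_set v x z"
    unfolding weyl_set_def using const by (auto simp: M)
qed

lemma weyl_set_antimono:
  assumes "z \<in> \<complex>\<^sub>+" "0 \<le> x" "x \<le> y"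
  shows "weyl_set v y z \<subseteq> weyl_set v x z"
proof
  fix \<phi> assume "\<phi> \<in> weyl_set v y z"
  then have "\<forall>f. 0 \<le> j_form (U y z *v vjoin f (\<phi> *v f))"
    using assms by (subst (asm) weyl_set_iff) auto
  then show "\<phi> \<in> weyl_set v x z"
    unfolding weyl_set_iff[OF assms(2,1)] using j_form_U_antimono[OF assms] order_trans by blast
qed

text \<open>The difference of two elements gives a solution starting in \<open>[0; h]\<close>, whose norm never
  drops below that of \<open>h\<close>, although the solutions attached to the elements of \<open>weyl_set v x z\<close>
  have square integral at most \<open>|f|\<^sup>2 / (2 Im z)\<close> on \<open>[0, x]\<close>.\<close>

lemma weyl_set_diff_bound:
  assumes z: "z \<in> \<complex>\<^sub>+" and x: "0 \<le> x" and \<phi>: "\<phi> \<in> weyl_set v x z" "\<psi> \<in> weyl_set v x z"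
  shows "x * Im z * (norm ((\<phi> - \<psi>) *v f))\<^sup>2 \<le> 2 * (norm f)\<^sup>2"
proof -
  have Im: "Im z > 0" using z by (simp add: upper_half_plane_def)
  define I where "I g = integral {0..x} (\<lambda>t. (norm (U t z *v g))\<^sup>2)" for g
  \<comment> \<open>Membership makes the form nonnegative at x, so the energy lost on the way is at
    most the initial form, which is at most the squared norm of f.\<close>
  have I: "2 * Im z * I (vjoin f (\<eta> *v f)) \<le> (norm f)\<^sup>2" if "\<eta> \<in> weyl_set v x z" for \<eta>
  proof -
    have "0 \<le> j_form (U x z *v vjoin f (\<eta> *v f))" using that x z by (simp add: weyl_set_iff)
    also have "\<dots> = j_form (vjoin f (\<eta> *v f)) - 2 * Im z * I (vjoin f (\<eta> *v f))"
      using j_form_U[OF x] by (simp add: I_def)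
    finally show ?thesis using zero_le_power2[of "norm (\<eta> *v f)"] unfolding j_form_vjoin by linarith
  qed
  define h where "h = (\<phi> - \<psi>) *v f"
  let ?g = "vjoin f (\<phi> *v f)" and ?g' = "vjoin f (\<psi> *v f)" and ?d = "vjoin 0 h :: complex^('m1 + 'm2)"
  have d: "?d = ?g - ?g'" by (simp add: vjoin_diff h_def matrix_vector_mult_diff_rdistrib)
  have int: "(\<lambda>t. (norm (U t z *v g))\<^sup>2) integrable_on {0..x}" for g using norm_U_integrable[OF x] .
  have "x * (norm h)\<^sup>2 = integral {0..x} (\<lambda>t. (norm h)\<^sup>2)" using x by simp
  also have "\<dots> \<le> integral {0..x} (\<lambda>t. 2 * (norm (U t z *v ?g))\<^sup>2 + 2 * (norm (U t z *v ?g'))\<^sup>2)"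
  proof (rule integral_le)
    show "(\<lambda>t. 2 * (norm (U t z *v ?g))\<^sup>2 + 2 * (norm (U t z *v ?g'))\<^sup>2) integrable_on {0..x}"
      using int[of ?g] int[of ?g'] by (intro integrable_add integrable_on_mult_right)
    fix t assume t: "t \<in> {0..x}"
    have "(norm h)\<^sup>2 = - j_form ?d" by (simp add: j_form_vjoin)
    also have "\<dots> \<le> - j_form (U t z *v ?d)" using j_form_U_le[OF z, of t ?d] t by simp
    also have "\<dots> \<le> (norm (U t z *v ?d))\<^sup>2" using j_form_lower[of "U t z *v ?d"] by simp
    also have "\<dots> = (norm (U t z *v ?g - U t z *v ?g'))\<^sup>2"
      by (simp add: d matrix_vector_mult_diff_distrib)
    also have "\<dots> \<le> (norm (U t z *v ?g) + norm (U t z *v ?g'))\<^sup>2"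
      by (intro power_mono norm_triangle_ineq4) auto
    also have "\<dots> \<le> 2 * (norm (U t z *v ?g))\<^sup>2 + 2 * (norm (U t z *v ?g'))\<^sup>2"
      using sum_squares_bound[of "norm (U t z *v ?g)" "norm (U t z *v ?g')"]
      by (simp add: power2_sum)
    finally show "(norm h)\<^sup>2 \<le> 2 * (norm (U t z *v ?g))\<^sup>2 + 2 * (norm (U t z *v ?g'))\<^sup>2" .
  qed auto
  also have "\<dots> = 2 * I ?g + 2 * I ?g'"
    using int[of ?g] int[of ?g']
    by (simp add: I_def Henstock_Kurzweil_Integration.integral_add integrable_on_mult_right)
  finally have "Im z * (x * (norm h)\<^sup>2) \<le> Im z * (2 * I ?g + 2 * I ?g')"
    using Im by (intro mult_left_mono) auto
  also have "\<dots> = 2 * Im z * I ?g + 2 * Im z * I ?g'" by (simp add: algebra_simps)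
  also have "\<dots> \<le> 2 * (norm f)\<^sup>2" using I[OF \<phi>(1)] I[OF \<phi>(2)] by simp
  finally show ?thesis by (simp add: h_def mult_ac)
qed

text \<open>The diameter bound tested on unit vectors. It depends on z only through
  \<open>Im z\<close>, which makes the later convergence locally uniform.\<close>

lemma weyl_set_entry_bound:
  fixes \<phi> \<psi> :: "complex^'m1^'m2"
  assumes z: "z \<in> \<complex>\<^sub>+" and x: "0 < x" and \<phi>: "\<phi> \<in> weyl_set v x z" "\<psi> \<in> weyl_set v x z"
  shows "norm (\<phi> $ i $ k - \<psi> $ i $ k) \<le> sqrt (2 / (x * Im z))"
proof -
  have Im: "Im z > 0" using z by (simp add: upper_half_plane_def)
  have "\<phi> $ i $ k - \<psi> $ i $ k = ((\<phi> - \<psi>) *v axis k 1) $ i"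
    by (simp add: matrix_vector_mult_axis)
  then have "norm (\<phi> $ i $ k - \<psi> $ i $ k) \<le> norm ((\<phi> - \<psi>) *v axis k 1)"
    by (simp only: Finite_Cartesian_Product.norm_nth_le)
  also have "\<dots> \<le> sqrt (2 / (x * Im z))"
  proof (rule real_le_rsqrt)
    have "x * Im z * (norm ((\<phi> - \<psi>) *v axis k 1))\<^sup>2 \<le> 2 * (norm (axis k 1 :: complex^'m1))\<^sup>2"
      using weyl_set_diff_bound[OF z less_imp_le[OF x] \<phi>] .
    then show "(norm ((\<phi> - \<psi>) *v axis k 1))\<^sup>2 \<le> 2 / (x * Im z)"
      using x Im by (simp add: field_simps norm_axis_1)
  qed
  finally show ?thesis .
qed

text \<open>Membership is a family of non-strict inequalities between continuous functions of
  \<phi>, hence stable under limits.\<close>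

lemma weyl_set_closed:
  assumes x: "0 \<le> x" and z: "z \<in> \<complex>\<^sub>+" and \<Phi>: "\<Phi> \<longlonglongrightarrow> \<phi>"
    and mem: "\<forall>\<^sub>F n in sequentially. \<Phi> n \<in> weyl_set v x z"
  shows "\<phi> \<in> weyl_set v x z"
  unfolding weyl_set_iff[OF x z]
proof
  fix f
  note tmv = bounded_bilinear.tendsto[OF bounded_bilinear_matrix_vector_mult]
  have "(\<lambda>n. j_form (U x z *v vjoin f (\<Phi> n *v f))) \<longlonglongrightarrow> j_form (U x z *v vjoin f (\<phi> *v f))"
    unfolding j_form_def by (intro tendsto_intros tmv tendsto_vjoin \<Phi>)
  moreover have "\<forall>\<^sub>F n in sequentially. 0 \<le> j_form (U x z *v vjoin f (\<Phi> n *v f))"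
    using mem by eventually_elim (use weyl_set_iff[OF x z] in blast)
  ultimately show "0 \<le> j_form (U x z *v vjoin f (\<phi> *v f))"
    by (intro tendsto_lowerbound[where F=sequentially]) auto
qed

text \<open>The value for the constant parameter [I; 0], taken at x = n + 1 so that the denominator
  in the diameter bound is positive from the start.\<close>

definition \<Phi> :: "nat \<Rightarrow> complex \<Rightarrow> complex^'m1^'m2" where
  "\<Phi> n z = weyl_phi v (real (Suc n)) z (\<lambda>_. vjoin (mat 1) 0)"

lemma exceptional_set_vjoin_1_0:
  "exceptional_set (\<lambda>_. vjoin (mat 1) 0 :: complex^'m1^('m1 + 'm2)) = {}"
  "nonsingular_property_j (\<lambda>_. vjoin (mat 1) 0 :: complex^'m1^('m1 + 'm2))"
proof -
  have *: "vjoin (mat 1) 0 *v f = (vjoin f 0 :: complex^('m1 + 'm2))" for f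
    by (simp add: matrix_vector_mult_vjoin bounded_bilinear.zero_left[OF bounded_bilinear_matrix_vector_mult])
  have "f = 0" if "vjoin f 0 = (0 :: complex^('m1 + 'm2))" for f
    using that by (simp add: vec_sum_eq_iff) (simp add: vec_eq_iff)
  then show "exceptional_set (\<lambda>_. vjoin (mat 1) 0 :: complex^'m1^('m1 + 'm2)) = {}"
    "nonsingular_property_j (\<lambda>_. vjoin (mat 1) 0 :: complex^'m1^('m1 + 'm2))"
    by (auto intro!: exceptional_set_const simp: * j_form_vjoin)
qed

lemma \<Phi>_mem:
  assumes "z \<in> \<complex>\<^sub>+" "0 \<le> x" "x \<le> real (Suc n)"
  shows "\<Phi> n z \<in> weyl_set v x z"
proof -
  have "\<Phi> n z \<in> weyl_set v (real (Suc n)) z"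
    unfolding weyl_set_def \<Phi>_def using exceptional_set_vjoin_1_0 by auto
  then show ?thesis using weyl_set_antimono[OF assms] by blast
qed

text \<open>The parameter is constant, so z enters only through the entire function
  \<open>U\<close>; products and inverses of invertible matrices preserve holomorphy.\<close>

lemma \<Phi>_holomorphic: "(\<lambda>z. \<Phi> n z $ i $ k) holomorphic_on \<complex>\<^sub>+"
proof -
  let ?x = "real (Suc n)" and ?P = "vjoin (mat 1) 0 :: complex^'m1^('m1 + 'm2)"
  have U: "(\<lambda>z. matrix_inv (U ?x z) $ i $ k) holomorphic_on \<complex>\<^sub>+" for i k
    using holomorphic_on_subset[OF fund_sol_properties(2)[OF summable_v, of ?x] subset_UNIV]
    by (intro matrix_inv_holomorphic U_invertible) auto
  have D: "(\<lambda>z. weyl_denom v ?x z (\<lambda>_. ?P) $ i $ k) holomorphic_on \<complex>\<^sub>+" for i k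
    unfolding weyl_denom_def by (intro matrix_mult_holomorphic U) auto
  show ?thesis
    unfolding \<Phi>_def weyl_phi_def
    by (intro matrix_mult_holomorphic U matrix_inv_holomorphic D weyl_denom_invertible)
       (auto simp: exceptional_set_vjoin_1_0)
qed

text \<open>The Weyl function as an entrywise limit; the limit is shown to exist on the upper
  half-plane.\<close>

definition \<phi>\<^sub>W :: "complex \<Rightarrow> complex^'m1^'m2" where
  "\<phi>\<^sub>W z = (\<chi> i k. lim (\<lambda>n. \<Phi> n z $ i $ k))"

text \<open>By nesting, both values lie in the Weyl set at \<open>real (Suc n)\<close>, the one of
  the smaller index, whose diameter bound applies.\<close>

lemma \<Phi>_diff:
  assumes "z \<in> \<complex>\<^sub>+" "n \<le> m"
  shows "norm (\<Phi> m z $ i $ k - \<Phi> n z $ i $ k) \<le> sqrt (2 / (real (Suc n) * Im z))"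
  using assms by (intro weyl_set_entry_bound \<Phi>_mem) auto

lemma entry_bound_tendsto_0: "(\<lambda>n. sqrt (2 / (real (Suc n) * c))) \<longlonglongrightarrow> 0"
proof -
  have "(\<lambda>n. sqrt ((2 / c) * inverse (real (Suc n)))) \<longlonglongrightarrow> sqrt ((2 / c) * 0)"
    by (intro tendsto_intros LIMSEQ_inverse_real_of_nat)
  then show ?thesis by (simp add: field_simps)
qed

lemma \<Phi>_tendsto_entry:
  assumes z: "z \<in> \<complex>\<^sub>+"
  shows "(\<lambda>n. \<Phi> n z $ i $ k) \<longlonglongrightarrow> \<phi>\<^sub>W z $ i $ k"
proof -
  have "Cauchy (\<lambda>n. \<Phi> n z $ i $ k)"
  proof (rule CauchyI)
    fix e :: real assume e: "e > 0"
    have "\<forall>\<^sub>F n in sequentially. sqrt (2 / (real (Suc n) * Im z)) < e / 2"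
      using order_tendstoD(2)[OF entry_bound_tendsto_0, of "e / 2"] e by simp
    \<comment> \<open>Both later terms are compared with the term of index \<open>N\<close>, hence
      half of e.\<close>
    then obtain N where N: "sqrt (2 / (real (Suc N) * Im z)) < e / 2"
      by (auto simp: eventually_sequentially)
    have "norm (\<Phi> m z $ i $ k - \<Phi> n z $ i $ k) < e" if "m \<ge> N" "n \<ge> N" for m n
    proof -
      have "norm (\<Phi> m z $ i $ k - \<Phi> n z $ i $ k) \<le>
          norm (\<Phi> m z $ i $ k - \<Phi> N z $ i $ k) + norm (\<Phi> n z $ i $ k - \<Phi> N z $ i $ k)"
        using norm_triangle_ineq4[of "\<Phi> m z $ i $ k - \<Phi> N z $ i $ k" "\<Phi> n z $ i $ k - \<Phi> N z $ i $ k"]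
        by simp
      then show ?thesis using \<Phi>_diff[OF z that(1), of i k] \<Phi>_diff[OF z that(2), of i k] N by linarith
    qed
    then show "\<exists>M. \<forall>m\<ge>M. \<forall>n\<ge>M. norm (\<Phi> m z $ i $ k - \<Phi> n z $ i $ k) < e" by blast
  qed
  then show ?thesis
    by (simp add: \<phi>\<^sub>W_def Cauchy_convergent_iff convergent_LIMSEQ_iff)
qed

text \<open>Letting the larger index tend to infinity in \<open>\<Phi>_diff\<close> keeps the
  explicit rate, needed for uniformity in z.\<close>

lemma \<Phi>_limit_diff:
  assumes z: "z \<in> \<complex>\<^sub>+"
  shows "norm (\<phi>\<^sub>W z $ i $ k - \<Phi> n z $ i $ k) \<le> sqrt (2 / (real (Suc n) * Im z))"
proof (rule tendsto_upperbound[where F=sequentially])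
  show "(\<lambda>m. norm (\<Phi> m z $ i $ k - \<Phi> n z $ i $ k)) \<longlonglongrightarrow> norm (\<phi>\<^sub>W z $ i $ k - \<Phi> n z $ i $ k)"
    by (intro tendsto_intros \<Phi>_tendsto_entry z)
  show "\<forall>\<^sub>F m in sequentially. norm (\<Phi> m z $ i $ k - \<Phi> n z $ i $ k) \<le> sqrt (2 / (real (Suc n) * Im z))"
    using \<Phi>_diff[OF z] unfolding eventually_sequentially by blast
qed auto

lemma \<phi>\<^sub>W_holomorphic: "(\<lambda>z. \<phi>\<^sub>W z $ i $ k) holomorphic_on \<complex>\<^sub>+"
proof (rule holomorphic_uniform_sequence[where f="\<lambda>n z. \<Phi> n z $ i $ k"])
  show op: "open \<complex>\<^sub>+" by (simp add: upper_half_plane_def open_halfspace_Im_gt)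
  show "(\<lambda>z. \<Phi> n z $ i $ k) holomorphic_on \<complex>\<^sub>+" for n by (rule \<Phi>_holomorphic)
  fix w assume w: "w \<in> \<complex>\<^sub>+"
  \<comment> \<open>On the closed disc of radius \<open>Im w / 2\<close> around w the imaginary part
    stays at least \<open>c\<close>, so one rate serves the whole disc.\<close>
  define c where "c = Im w / 2"
  have c: "c > 0" using w by (simp add: c_def upper_half_plane_def)
  have Im: "c \<le> Im z" if "z \<in> cball w c" for z
  proof -
    have "\<bar>Im (w - z)\<bar> \<le> c" using that abs_Im_le_cmod[of "w - z"] by (simp add: dist_norm)
    then show ?thesis unfolding c_def minus_complex.sel by linarith
  qed
  have sub: "cball w c \<subseteq> \<complex>\<^sub>+" using Im c by (force simp: upper_half_plane_def)
  have "uniform_limit (cball w c) (\<lambda>n z. \<Phi> n z $ i $ k) (\<lambda>z. \<phi>\<^sub>W z $ i $ k) sequentially"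
  proof (rule uniform_limitI)
    fix e :: real assume e: "e > 0"
    have "\<forall>\<^sub>F n in sequentially. sqrt (2 / (real (Suc n) * c)) < e"
      using order_tendstoD(2)[OF entry_bound_tendsto_0 e] .
    then show "\<forall>\<^sub>F n in sequentially. \<forall>z\<in>cball w c. dist (\<Phi> n z $ i $ k) (\<phi>\<^sub>W z $ i $ k) < e"
    proof eventually_elim
      case (elim n)
      show ?case
      proof
        fix z assume z: "z \<in> cball w c"
        have "norm (\<phi>\<^sub>W z $ i $ k - \<Phi> n z $ i $ k) \<le> sqrt (2 / (real (Suc n) * Im z))"
          using z sub by (intro \<Phi>_limit_diff) auto
        also have "\<dots> \<le> sqrt (2 / (real (Suc n) * c))"
          using Im[OF z] c by (intro real_sqrt_le_mono divide_left_mono mult_left_mono) auto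
        also note elim
        finally show "dist (\<Phi> n z $ i $ k) (\<phi>\<^sub>W z $ i $ k) < e"
          by (simp add: dist_norm norm_minus_commute)
      qed
    qed
  qed
  then show "\<exists>d>0. cball w d \<subseteq> \<complex>\<^sub>+ \<and>
      uniform_limit (cball w d) (\<lambda>n z. \<Phi> n z $ i $ k) (\<lambda>z. \<phi>\<^sub>W z $ i $ k) sequentially"
    using c sub by blast
qed

text \<open>By nesting all but finitely many approximants lie in the Weyl set at x, and this set is
  closed.\<close>

lemma \<phi>\<^sub>W_mem:
  assumes z: "z \<in> \<complex>\<^sub>+" and x: "0 \<le> x"
  shows "\<phi>\<^sub>W z \<in> weyl_set v x z"
proof (rule weyl_set_closed[OF x z])
  show "(\<lambda>n. \<Phi> n z) \<longlonglongrightarrow> \<phi>\<^sub>W z"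
    by (intro vec_tendstoI \<Phi>_tendsto_entry z)
  obtain N where "x \<le> real N" using real_arch_simple by blast
  then show "\<forall>\<^sub>F n in sequentially. \<Phi> n z \<in> weyl_set v x z"
    unfolding eventually_sequentially by (intro exI[of _ N] allI impI \<Phi>_mem z x) auto
qed

text \<open>An element of the intersection shares every Weyl set with
  \<open>\<phi>\<^sub>W z\<close>, and the diameters tend to 0.\<close>

lemma weyl_set_Inter:
  assumes z: "z \<in> \<complex>\<^sub>+"
  shows "(\<Inter>x\<in>{0..}. weyl_set v x z) = {\<phi>\<^sub>W z}"
proof (intro equalityI subsetI)
  fix \<psi> :: "complex^'m1^'m2" assume "\<psi> \<in> (\<Inter>x\<in>{0..}. weyl_set v x z)"
  then have \<psi>: "\<psi> \<in> weyl_set v (real (Suc n)) z" for n by auto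
  have "norm (\<psi> $ i $ k - \<phi>\<^sub>W z $ i $ k) \<le> sqrt (2 / (real (Suc n) * Im z))" for n i k
    using z \<psi> by (intro weyl_set_entry_bound \<phi>\<^sub>W_mem) auto
  then have "norm (\<psi> $ i $ k - \<phi>\<^sub>W z $ i $ k) \<le> 0" for i k
    by (intro tendsto_lowerbound[OF entry_bound_tendsto_0[of "Im z"]]) auto
  then show "\<psi> \<in> {\<phi>\<^sub>W z}" by (simp add: vec_eq_iff)
qed (use \<phi>\<^sub>W_mem[OF z] in auto)

text \<open>This is membership at x = 0: there \<open>U\<close> is the identity, and the form at
  [f; \<phi> f] is the squared norm of f minus that of \<phi> f.\<close>

lemma \<phi>\<^sub>W_nonexpansive:
  assumes z: "z \<in> \<complex>\<^sub>+"
  shows "loewner_le (mat_adj (\<phi>\<^sub>W z) ** \<phi>\<^sub>W z) (mat 1)"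
proof -
  let ?A = "mat 1 - mat_adj (\<phi>\<^sub>W z) ** \<phi>\<^sub>W z"
  have "mat_adj ?A = ?A" by (simp add: mat_adj_diff mat_adj_mat mat_adj_mult mat_adj_mat_adj)
  moreover have "0 \<le> Re (quad_form ?A f)" for f
  proof -
    have "0 \<le> j_form (vjoin f (\<phi>\<^sub>W z *v f))"
      using \<phi>\<^sub>W_mem[OF z order_refl] weyl_set_iff[OF order_refl z] by (simp add: U_0)
    also have "\<dots> = Re (quad_form ?A f)"
      by (simp add: j_form_vjoin Re_quad_form matrix_vector_mult_diff_rdistrib inner_diff_right
          power2_norm_eq_inner inner_mat_adj matrix_vector_mul_assoc[symmetric])
    finally show ?thesis .
  qed
  ultimately show ?thesis by (simp add: loewner_le_def pos_semidef_def)
qed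

end

theorem proposition2p2:
  fixes v :: "real \<Rightarrow> complex^'m2^'m1"
  assumes "v \<in> borel_measurable (lebesgue_on {0..})"
    and "\<And>l. 0 \<le> l \<Longrightarrow> v absolutely_integrable_on {0..l}"
  shows "(\<forall>x\<ge>0. \<forall>z\<in>\<complex>\<^sub>+. \<forall>P :: complex \<Rightarrow> complex^'m1^('m1 + 'm2).
            nonsingular_property_j P \<and> z \<notin> exceptional_set P \<longrightarrow> invertible (weyl_denom v x z P)) \<and>
         (\<exists>\<phi> :: complex \<Rightarrow> complex^'m1^'m2.
            (\<forall>z\<in>\<complex>\<^sub>+. {\<phi> z} = (\<Inter>x\<in>{0..}. weyl_set v x z)) \<and>
            (\<forall>\<psi>. (\<forall>z\<in>\<complex>\<^sub>+. {\<psi> z} = (\<Inter>x\<in>{0..}. weyl_set v x z)) \<longrightarrow> (\<forall>z\<in>\<complex>\<^sub>+. \<psi> z = \<phi> z)) \<and>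
            (\<forall>i k. (\<lambda>z. \<phi> z $ i $ k) analytic_on \<complex>\<^sub>+) \<and>
            (\<forall>z\<in>\<complex>\<^sub>+. loewner_le (mat_adj (\<phi> z) ** \<phi> z) (mat 1)))"
proof -
  interpret dirac_system v using assms(2) by unfold_locales
  have "open \<complex>\<^sub>+" by (simp add: upper_half_plane_def open_halfspace_Im_gt)
  then have "(\<lambda>z. \<phi>\<^sub>W z $ i $ k) analytic_on \<complex>\<^sub>+" for i k
    using \<phi>\<^sub>W_holomorphic by (simp add: analytic_on_open)
  then show ?thesis
    using weyl_denom_invertible \<phi>\<^sub>W_nonexpansive
    by (intro conjI exI[of _ \<phi>\<^sub>W]) (auto simp: weyl_set_Inter)
qed

end
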